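(* Let $C,\gamma>0$. There exist constants $C_{\rm LU}>0$ and $p>2$ (depending only on $C,\gamma$) such that for every $n\in\mathbb{N}$ and every $M\in\mathbb{R}^{n\times n}$ with $\|M\|_{S_\infty}\le C$ and $\max_{1\le j\le n}\|(M|_{j\times j})^{-1}\|_{S_\infty}\le1/\gamma$, $M$ has an $LU$-factorization $M=LU$ with $L$ unit lower triangular ($L_{ii}=1$) and $U$ upper triangular satisfying $$\|L\|_{S_\infty}+\|U\|_{S_\infty}+\|L^{-1}\|_{S_\infty}+\|U^{-1}\|_{S_\infty}\le C_{\rm LU}\,n^{1/p}.$$
   Context: $\|\cdot\|_{S_\infty}$ denotes the spectral norm; $M|_{j\times j}$ is the upper left $j\times j$ submatrix of $M$ (assumed invertible for all $j$). *)

theory Defs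
  imports Complex_Main "Jordan_Normal_Form.Matrix"
begin

definition vec_l2 :: "real vec \<Rightarrow> real" where
  "vec_l2 v = sqrt (\<Sum>i<dim_vec v. (v $ i)^2)"

definition spec_norm :: "real mat \<Rightarrow> real" where
  "spec_norm A = Sup {vec_l2 (A *\<^sub>v v) | v. v \<in> carrier_vec (dim_col A) \<and> vec_l2 v \<le> 1}"

definition ul_sub :: "'a mat \<Rightarrow> nat \<Rightarrow> 'a mat" where
  "ul_sub M j = mat j j (\<lambda>(a,b). M $$ (a,b))"

definition is_inverse_of :: "real mat \<Rightarrow> real mat \<Rightarrow> bool" where
  "is_inverse_of B A \<longleftrightarrow> square_mat A \<and> B \<in> carrier_mat (dim_row A) (dim_row A)
     \<and> inverts_mat A B \<and> inverts_mat B A"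

definition unit_lower_triangular :: "real mat \<Rightarrow> bool" where
  "unit_lower_triangular L \<longleftrightarrow> (\<forall>i<dim_row L. \<forall>j<dim_col L. i < j \<longrightarrow> L $$ (i,j) = 0)
     \<and> (\<forall>i<dim_row L. L $$ (i,i) = 1)"

end

theory Submission
  imports Defs "HOL-Analysis.Generalised_Binomial_Theorem" "Jordan_Normal_Form.Determinant"
begin

text \<open>
  Put $z = M^T v$ and let $y^k$ be the Galerkin solution of $M^T y = z$ on the first $k$ coordinates,
  padded with zeros. The $k$-th entry of $L^T v$ is the last entry of $y^k$, so the sum of their squares
  has to be bounded by $n^{1-2e} |z|^2$ for some small $e > 0$. The matrix $Y$ with columns $y^k$ is
  upper triangular and $z 1^T - M^T Y$ is strictly lower triangular. Convolve the rows of $Y$ with the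
  coefficients $c$ of $(1-x)^e$, once causally (giving $X$, still upper triangular) and once
  anticausally (giving $H$). The symbol $(1-x)^e$ has argument $O(e)$ on the unit circle, hence
  $|X - H| = O(e) |X|$ in the Frobenius norm. On and above the diagonal $M^T H = z q^T$, where the
  entries of $q$ are partial sums of $c$ and decay like $m^{-e}$. Stability of the sections therefore gives
  $\gamma |X| \le |z| |q| + C |X - H|$, in which the last term is absorbed for small $e$,
  and $|q|^2 = O(n^{1-2e})$. Since $c_0 = 1$, the diagonal of $X$ is that of $Y$.

  The columns $M_j^{-1} e_j$ form $U^{-1}$ and give $L = M U^{-1}$; the rows $e_j^T M_j^{-1}$ give
  $L^{-1}$ up to the pivots, and they are the same construction for $M^T$.
\<close>

section \<open>Fractional differences\<close>

text \<open>Bernoulli's inequality for exponents in [0,1]: Young's inequality for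
  \<open>1 + t\<close> and \<open>1\<close> with weights \<open>e\<close> and
  \<open>1 - e\<close>.\<close>

lemma powr_one_plus_le:
  fixes t e :: real
  assumes "0 \<le> e" "e \<le> 1" "t > -1"
  shows "(1 + t) powr e \<le> 1 + e * t"
  using Youngs_inequality_0[of e "1 - e" "1 + t" 1] assms by (simp add: algebra_simps)

lemma gbinomial_Suc_mult:
  fixes a :: real
  shows "(a gchoose Suc k) = (a gchoose k) * ((a - real k) / real (Suc k))"
  by (simp add: gbinomial_prod_rev prod.atLeast0_lessThan_Suc)

lemma abs_gbinomial_le_one:
  fixes e :: real
  assumes "0 \<le> e" "e \<le> 1"
  shows "\<bar>e gchoose k\<bar> \<le> 1"
proof (induction k)
  case (Suc k)
  have "\<bar>e gchoose Suc k\<bar> = \<bar>e gchoose k\<bar> * (\<bar>e - real k\<bar> / real (Suc k))"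
    by (simp add: gbinomial_Suc_mult abs_mult)
  also have "\<dots> \<le> 1 * 1"
    using Suc assms by (intro mult_mono) (auto simp: divide_le_eq_1)
  finally show ?case by simp
qed simp

text \<open>The partial sum up to \<open>m\<close> is the product of the factors 1 - e/k over 1
  \<le> k \<le> m. Each factor is nonnegative and at most (1 + 1/k)^(-e), and these bounds telescope
  to (m+1)^(-e).\<close>

lemma binomial_series_partial_sum_bounds:
  fixes e :: real
  assumes "0 \<le> e" "e \<le> 1"
  shows "0 \<le> (\<Sum>k\<le>m. (e gchoose k) * (- 1) ^ k)"
    and "(\<Sum>k\<le>m. (e gchoose k) * (- 1) ^ k) \<le> real (Suc m) powr (- e)"
proof -
  define S where "S m = (\<Sum>k\<le>m. (e gchoose k) * (- 1) ^ k)" for m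
  have rec: "S (Suc m) = S m * (1 - e / real (Suc m))" for m
    unfolding S_def gbinomial_sum_lower_neg gbinomial_Suc_mult by (simp add: field_simps)
  have "0 \<le> S m \<and> S m \<le> real (Suc m) powr (- e)"
  proof (induction m)
    case 0
    then show ?case by (simp add: S_def)
  next
    case (Suc m)
    define t where "t = 1 / real (Suc m)"
    have t: "0 < t" "t \<le> 1" by (auto simp: t_def)
    have et: "0 \<le> e * t" "e * t \<le> 1" using t assms by (auto intro: mult_le_one)
    have "(1 - e * t) * (1 + t) powr e \<le> (1 - e * t) * (1 + e * t)"
      using powr_one_plus_le[of e t] t et assms by (intro mult_left_mono) auto
    also have "\<dots> \<le> 1" using zero_le_square[of "e * t"] by (simp add: algebra_simps)
    finally have "1 - e * t \<le> (1 + t) powr (- e)"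
      using t by (simp add: powr_minus field_simps)
    then have "S m * (1 - e * t) \<le> real (Suc m) powr (- e) * (1 + t) powr (- e)"
      using Suc et by (intro mult_mono) auto
    also have "\<dots> = (real (Suc m) * (1 + t)) powr (- e)"
      using t by (simp add: powr_mult)
    also have "real (Suc m) * (1 + t) = real (Suc (Suc m))"
      by (simp add: t_def field_simps)
    finally have "S (Suc m) \<le> real (Suc (Suc m)) powr (- e)"
      by (simp add: rec t_def)
    moreover have "0 \<le> S (Suc m)"
      using Suc et by (simp add: rec t_def)
    ultimately show ?case by blast
  qed
  then show "0 \<le> (\<Sum>k\<le>m. (e gchoose k) * (- 1) ^ k)"
    and "(\<Sum>k\<le>m. (e gchoose k) * (- 1) ^ k) \<le> real (Suc m) powr (- e)"
    by (auto simp: S_def)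
qed

text \<open>The discrete form of integrating x^(-s). The induction step is the tangent bound for the
  concave function x^(1-s) at N = n + 1.\<close>

lemma sum_powr_neg_le:
  fixes s :: real
  assumes "0 \<le> s" "s < 1"
  shows "(\<Sum>m<n. real (Suc m) powr (- s)) \<le> real n powr (1 - s) / (1 - s)"
proof (induction n)
  case (Suc n)
  define N where "N = real (Suc n)"
  have N: "N > 0" by (simp add: N_def)
  have "real n powr (1 - s) \<le> N powr (1 - s) * (1 - (1 - s) / N)"
  \<comment> \<open>For \<open>n = 0\<close> the increment -1/N equals -1, which the Bernoulli bound
    excludes; the left side is then 0.\<close>
  proof (cases "n = 0")
    case True
    then show ?thesis using assms by (simp add: N_def)
  next
    case False
    have "(1 + (- 1 / N)) powr (1 - s) \<le> 1 + (1 - s) * (- 1 / N)"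
      using assms False by (intro powr_one_plus_le) (auto simp: N_def field_simps)
    then have "N powr (1 - s) * (1 - 1 / N) powr (1 - s) \<le> N powr (1 - s) * (1 - (1 - s) / N)"
      by (intro mult_left_mono) auto
    also have "N powr (1 - s) * (1 - 1 / N) powr (1 - s) = (N * (1 - 1 / N)) powr (1 - s)"
      using N by (subst powr_mult) (auto simp: N_def)
    also have "N * (1 - 1 / N) = real n" using N by (simp add: field_simps N_def)
    finally show ?thesis .
  qed
  also have "\<dots> = N powr (1 - s) - (1 - s) * N powr (- s)"
    using N by (simp add: powr_diff powr_minus field_simps)
  finally have "(real n powr (1 - s) + (1 - s) * N powr (- s)) / (1 - s) \<le> N powr (1 - s) / (1 - s)"
    using assms by (intro divide_right_mono) auto
  then have "real n powr (1 - s) / (1 - s) + N powr (- s) \<le> N powr (1 - s) / (1 - s)"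
    using assms by (simp add: add_divide_distrib)
  then show ?case using Suc by (simp add: N_def)
qed simp

section \<open>Powers of small argument and their Taylor polynomials\<close>

lemma of_real_gbinomial:
  "complex_of_real (a gchoose k) = (complex_of_real a gchoose k)"
  by (simp add: gbinomial_prod_rev)

text \<open>In the open right half-plane the argument has modulus below pi/2 < 2, so that of the
  power is at most 2e in modulus, and its sine is no larger.\<close>

lemma Im_powr_le:
  assumes "Re z > 0" "0 \<le> e"
  shows "\<bar>Im (z powr of_real e)\<bar> \<le> 2 * e * cmod (z powr of_real e)"
proof -
  have z: "z \<noteq> 0" using assms by auto
  define \<theta> where "\<theta> = e * Im (Ln z)"
  have pw: "z powr of_real e = exp (of_real e * Ln z)" using z by (simp add: powr_def)
  have "\<bar>Im (Ln z)\<bar> < pi / 2" using assms Re_Ln_pos_lt[OF z] by simp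
  then have "\<bar>Im (Ln z)\<bar> \<le> 2" using pi_less_4 by linarith
  then have "\<bar>\<theta>\<bar> \<le> 2 * e" using assms mult_left_mono[of "\<bar>Im (Ln z)\<bar>" 2 e]
    by (simp add: \<theta>_def abs_mult)
  then have "\<bar>sin \<theta>\<bar> \<le> 2 * e" using abs_sin_x_le_abs_x[of \<theta>] by linarith
  then have "exp (e * Re (Ln z)) * \<bar>sin \<theta>\<bar> \<le> exp (e * Re (Ln z)) * (2 * e)"
    by (intro mult_left_mono) auto
  then show ?thesis
    by (simp add: pw Im_exp abs_mult \<theta>_def mult_ac)
qed

text \<open>The coefficients are those of a Taylor polynomial of $(1-\rho z)^e$ with $\rho < 1$ close to 1:
  the argument of this function is $e$ times that of $1-\rho z$, and its partial sums at $\rho = 1$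
  decay like $m^{-e}$.\<close>

lemma small_argument_polynomial:
  fixes e :: real and n :: nat
  assumes e: "0 < e" "e < 1 / 2" and n: "n > 0"
  shows "\<exists>d c. c 0 = (1::real) \<and> (\<forall>s>d. c s = 0)
     \<and> (\<Sum>m<n. (\<Sum>k\<le>m. c k)\<^sup>2) \<le> 2 / (1 - 2 * e) * real n powr (1 - 2 * e)
     \<and> (\<forall>w. cmod w = 1 \<longrightarrow> \<bar>Im (\<Sum>s\<le>d. of_real (c s) * w ^ s)\<bar>
            \<le> 4 * e * cmod (\<Sum>s\<le>d. of_real (c s) * w ^ s))"
proof -
  define b where "b k = (e gchoose k) * (- 1) ^ k" for k
  define K where "K = real n powr (1 - 2 * e) / (1 - 2 * e)"
  have Kpos: "K > 0" using e n by (simp add: K_def)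
  have b1: "\<bar>b k\<bar> \<le> 1" for k
    using abs_gbinomial_le_one[of e k] e by (simp add: b_def abs_mult power_abs)
  define Q where "Q \<rho> = (\<Sum>m<n. (\<Sum>k\<le>m. b k * \<rho> ^ k)\<^sup>2)" for \<rho> :: real
  have "Q 1 \<le> (\<Sum>m<n. real (Suc m) powr (- (2 * e)))"
    unfolding Q_def
  proof (rule sum_mono)
    fix m
    have "(\<Sum>k\<le>m. b k)\<^sup>2 \<le> (real (Suc m) powr (- e))\<^sup>2"
      using binomial_series_partial_sum_bounds[of e m] e unfolding b_def by (intro power_mono) auto
    also have "\<dots> = real (Suc m) powr (- (2 * e))"
      by (simp add: power2_eq_square flip: powr_add)
    finally show "(\<Sum>k\<le>m. b k * 1 ^ k)\<^sup>2 \<le> real (Suc m) powr (- (2 * e))" by simp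
  qed
  also have "\<dots> \<le> K" unfolding K_def using e by (intro sum_powr_neg_le) auto
  \<comment> \<open>The slack between \<open>K\<close> and \<open>2 * K\<close> allows \<rho> to
    move below 1, since \<open>Q\<close> is continuous; this is the origin of the factor 2 in the
    claim.\<close>
  finally have "Q 1 < 2 * K" using Kpos by linarith
  moreover have "(Q \<longlongrightarrow> Q 1) (at_left 1)"
    unfolding Q_def by (intro tendsto_intros)
  ultimately have "eventually (\<lambda>\<rho>. Q \<rho> < 2 * K) (at_left 1)"
    by (auto intro: order_tendstoD)
  moreover have "eventually (\<lambda>\<rho>::real. 0 < \<rho> \<and> \<rho> < 1) (at_left 1)"
    using eventually_at_left_real[of 0 1] by (auto elim: eventually_mono)
  ultimately have "eventually (\<lambda>\<rho>. Q \<rho> < 2 * K \<and> 0 < \<rho> \<and> \<rho> < 1) (at_left 1)"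
    by (rule eventually_conj)
  then obtain \<rho> where \<rho>: "0 < \<rho>" "\<rho> < 1" "Q \<rho> < 2 * K"
    by (auto dest!: eventually_happens)
  define a where "a k = b k * \<rho> ^ k" for k
  define F where "F w = (1 - of_real \<rho> * w) powr complex_of_real e" for w
  define T where "T d w = (\<Sum>s\<le>d. complex_of_real (a s) * w ^ s)" for d w
  \<comment> \<open>The tolerated truncation error. As |F w| \<ge> 1 - \<rho> on the unit circle,
    this size gives 2e|F w| + \<tau> \<le> 4e(|F w| - \<tau>), so truncation at most doubles the
    cone constant from 2e to 4e.\<close>
  define \<tau> where "\<tau> = (1 - \<rho>) * (e / (1 + 2 * e))"
  have \<tau>: "\<tau> > 0" using \<rho> e by (simp add: \<tau>_def)
  have "(\<lambda>d. \<rho> ^ d / (1 - \<rho>)) \<longlonglongrightarrow> 0 / (1 - \<rho>)"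
    using \<rho> by (intro tendsto_intros LIMSEQ_power_zero) auto
  then have "eventually (\<lambda>d. \<rho> ^ d / (1 - \<rho>) < \<tau>) sequentially"
    using \<tau> by (auto intro: order_tendstoD)
  \<comment> \<open>With \<open>n \<le> d\<close> the truncation leaves all partial sums of index
    below \<open>n\<close> unchanged.\<close>
  then have "eventually (\<lambda>d. \<rho> ^ d / (1 - \<rho>) < \<tau> \<and> n \<le> d) sequentially"
    using eventually_ge_at_top by (rule eventually_conj)
  then obtain d where d: "\<rho> ^ d / (1 - \<rho>) < \<tau>" "n \<le> d"
    by (auto simp: eventually_sequentially)
  have cone: "\<bar>Im (T d w)\<bar> \<le> 4 * e * cmod (T d w)" if w: "cmod w = 1" for w
  proof -
    have \<rho>w: "cmod (of_real \<rho> * w) = \<rho>" using w \<rho> by (simp add: norm_mult)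
    have "(of_real e gchoose k) * (- (of_real \<rho> * w)) ^ k = complex_of_real (a k) * w ^ k" for k
      by (simp add: a_def b_def of_real_gbinomial power_minus[of "of_real \<rho> * w"] power_mult_distrib)
    then have sums: "(\<lambda>k. complex_of_real (a k) * w ^ k) sums F w"
      using gen_binomial_complex[of "- (of_real \<rho> * w)" "of_real e"] \<rho>w \<rho> by (simp add: F_def)
    have nrm: "cmod (complex_of_real (a k) * w ^ k) \<le> \<rho> ^ k" for k
      using b1[of k] \<rho> w by (simp add: a_def norm_mult norm_power abs_mult mult_le_cancel_right1)
    have "(\<lambda>k. complex_of_real (a (k + Suc d)) * w ^ (k + Suc d)) sums (F w - T d w)"
      using sums_split_initial_segment[OF sums, of "Suc d"]
      by (simp add: T_def lessThan_Suc_atMost)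
    moreover have "(\<lambda>k. \<rho> ^ d * \<rho> ^ k) sums (\<rho> ^ d * (1 / (1 - \<rho>)))"
      using \<rho> by (intro sums_mult geometric_sums) auto
    moreover have "cmod (complex_of_real (a (k + Suc d)) * w ^ (k + Suc d)) \<le> \<rho> ^ d * \<rho> ^ k" for k
    proof -
      have "\<rho> ^ (k + Suc d) \<le> \<rho> ^ (d + k)" using \<rho> by (intro power_decreasing) auto
      then show ?thesis using nrm[of "k + Suc d"] by (simp only: power_add)
    qed
    ultimately have "cmod (F w - T d w) \<le> \<rho> ^ d * (1 / (1 - \<rho>))"
      by (metis (no_types, lifting) norm_sums_le)
    then have diff: "cmod (F w - T d w) \<le> \<tau>" using d by simp
    \<comment> \<open>A lower bound on |F w| turns the absolute truncation error into a relative
      one. Since e < 1 and 1 - \<rho> < 1, the power (1 - \<rho>)^e is at least 1 - \<rho>.\<close>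
    have "1 - \<rho> \<le> cmod (1 - of_real \<rho> * w)"
      using norm_triangle_ineq2[of 1 "of_real \<rho> * w"] \<rho>w by simp
    then have "(1 - \<rho>) powr e \<le> cmod (1 - of_real \<rho> * w) powr e"
      using \<rho> e by (intro powr_mono2) auto
    moreover have "(1 - \<rho>) powr 1 \<le> (1 - \<rho>) powr e"
      using \<rho> e by (intro powr_mono') auto
    ultimately have Flow: "1 - \<rho> \<le> cmod (F w)"
      using \<rho> unfolding F_def by (simp add: norm_powr_real_powr')
    have "Re (1 - of_real \<rho> * w) > 0"
      unfolding minus_complex.sel one_complex.sel
      using complex_Re_le_cmod[of "of_real \<rho> * w"] \<rho>w \<rho> by linarith
    then have "\<bar>Im (F w)\<bar> \<le> 2 * e * cmod (F w)"
      unfolding F_def using e by (intro Im_powr_le) auto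
    moreover have "\<bar>Im (T d w)\<bar> \<le> \<bar>Im (F w)\<bar> + \<tau>"
      using abs_Im_le_cmod[of "F w - T d w"] diff by simp
    moreover have "cmod (F w) \<le> cmod (T d w) + \<tau>"
      using norm_triangle_ineq2[of "F w" "T d w"] diff by linarith
    moreover have "2 * e * cmod (F w) + \<tau> \<le> 4 * e * (cmod (F w) - \<tau>)"
    proof -
      have "(1 + 4 * e) * \<tau> \<le> 2 * ((1 + 2 * e) * \<tau>)" using \<tau> by (simp add: algebra_simps)
      also have "(1 + 2 * e) * \<tau> = (1 - \<rho>) * e" using e by (simp add: \<tau>_def)
      also have "2 * ((1 - \<rho>) * e) \<le> 2 * (cmod (F w) * e)"
        using Flow e by (intro mult_left_mono mult_right_mono) auto
      finally show ?thesis by (simp add: algebra_simps)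
    qed
    moreover have "4 * e * (cmod (F w) - \<tau>) \<le> 4 * e * cmod (T d w)"
      using calculation(3) e by (intro mult_left_mono) auto
    ultimately show ?thesis by linarith
  qed
  define c where "c k = (if k \<le> d then a k else 0)" for k
  have "(\<Sum>m<n. (\<Sum>k\<le>m. c k)\<^sup>2) = Q \<rho>"
    unfolding Q_def using d(2)
    by (intro sum.cong refl arg_cong[where f = "\<lambda>x. x\<^sup>2"]) (auto simp: c_def a_def)
  then have "(\<Sum>m<n. (\<Sum>k\<le>m. c k)\<^sup>2) \<le> 2 / (1 - 2 * e) * real n powr (1 - 2 * e)"
    using \<rho>(3) by (simp add: K_def)
  moreover have "(\<Sum>s\<le>d. of_real (c s) * w ^ s) = T d w" for w
    by (simp add: T_def c_def)
  moreover have "c 0 = 1" "\<forall>s>d. c s = 0" by (auto simp: c_def a_def b_def)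
  ultimately show ?thesis using cone by (intro exI[of _ d] exI[of _ c]) simp
qed

section \<open>Causal and anticausal convolution\<close>

text \<open>Orthogonality of the characters of Z/N: the summands are powers of one N-th root of
  unity \<open>w\<close>. Since |a - b| < N, \<open>w = 1\<close> only for \<open>a = b\<close>;
  otherwise the geometric sum vanishes.\<close>

lemma sum_roots_of_unity_power:
  fixes N a b :: nat
  assumes "a < N" "b < N"
  shows "(\<Sum>r<N. cis (2 * pi * real r / real N) ^ a * cnj (cis (2 * pi * real r / real N)) ^ b)
    = (if a = b then of_nat N else 0)"
proof -
  define w where "w = cis (2 * pi * (real a - real b) / real N)"
  have N: "N > 0" using assms by simp
  have term_eq: "cis (2 * pi * real r / real N) ^ a * cnj (cis (2 * pi * real r / real N)) ^ b = w ^ r" for r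
    unfolding w_def cis_cnj Complex.DeMoivre cis_mult
    by (rule arg_cong[where f = cis]) (use N in \<open>simp add: field_simps\<close>)
  show ?thesis
  proof (cases "a = b")
    case True
    then have "w = 1" by (simp add: w_def)
    then show ?thesis unfolding term_eq using True by simp
  next
    case False
    have "w \<noteq> 1"
    proof
      assume "w = 1"
      then have "cos (2 * pi * (real a - real b) / real N) = 1"
        by (simp add: w_def complex_eq_iff)
      then obtain k :: int where k: "2 * pi * (real a - real b) / real N = of_int k * 2 * pi"
        by (auto simp: cos_one_2pi_int)
      then have "(2 * pi) * ((real a - real b) / real N) = (2 * pi) * of_int k" by (simp add: mult_ac)
      then have "(real a - real b) / real N = of_int k" by (subst (asm) mult_cancel_left) simp
      then have "real a - real b = of_int k * real N" using N by (simp add: field_simps)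
      then have "real_of_int (int a - int b) = real_of_int (k * int N)" by simp
      then have "int a - int b = k * int N" by (simp only: of_int_eq_iff)
      then have "int N dvd int a - int b" by simp
      then show False using False assms dvd_imp_le_int[of "int a - int b" "int N"] by auto
    qed
    moreover have "w ^ N = 1"
    proof -
      have "w ^ N = cis (2 * pi * (real a - real b))"
        unfolding w_def Complex.DeMoivre using N by simp
      then show ?thesis by (simp add: cis_multiple_2pi)
    qed
    ultimately have "(\<Sum>r<N. w ^ r) = 0" by (simp add: geometric_sum)
    then show ?thesis using False by (simp add: term_eq)
  qed
qed

text \<open>Expanding the squared modulus into a double sum and applying orthogonality leaves the
  diagonal. Sampling at N roots of unity replaces an integral over the circle, as the sequence has
  length N.\<close>

lemma finite_parseval:
  fixes f :: "nat \<Rightarrow> real"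
  shows "(\<Sum>r<N. (cmod (\<Sum>t<N. of_real (f t) * cis (2 * pi * real r / real N) ^ t))\<^sup>2)
    = real N * (\<Sum>t<N. (f t)\<^sup>2)"
proof -
  let ?w = "\<lambda>r. cis (2 * pi * real r / real N)"
  have "complex_of_real (\<Sum>r<N. (cmod (\<Sum>t<N. of_real (f t) * ?w r ^ t))\<^sup>2)
    = (\<Sum>r<N. (\<Sum>a<N. of_real (f a) * ?w r ^ a) * (\<Sum>b<N. of_real (f b) * cnj (?w r) ^ b))"
    by (simp only: of_real_sum complex_norm_square cnj_sum complex_cnj_mult complex_cnj_power
      complex_cnj_complex_of_real)
  also have "\<dots> = (\<Sum>r<N. \<Sum>a<N. \<Sum>b<N. of_real (f a * f b) * (?w r ^ a * cnj (?w r) ^ b))"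
    by (simp add: sum_product mult_ac)
  also have "\<dots> = (\<Sum>a<N. \<Sum>b<N. \<Sum>r<N. of_real (f a * f b) * (?w r ^ a * cnj (?w r) ^ b))"
    by (rule trans[OF sum.swap]) (intro sum.cong refl sum.swap)
  also have "\<dots> = (\<Sum>a<N. \<Sum>b<N. of_real (f a * f b) * (if a = b then of_nat N else 0))"
    by (intro sum.cong refl) (simp only: sum_distrib_left[symmetric] sum_roots_of_unity_power lessThan_iff)
  also have "\<dots> = (\<Sum>a<N. of_real (real N * (f a)\<^sup>2))"
    by (intro sum.cong refl) (simp add: if_distrib power2_eq_square mult_ac cong: if_cong)
  also have "\<dots> = of_real (real N * (\<Sum>t<N. (f t)\<^sup>2))"
    by (simp add: sum_distrib_left)
  finally show ?thesis by (simp only: of_real_eq_iff)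
qed

text \<open>A delay by \<open>a\<close> multiplies the transform by w^a. The condition
  \<open>a + d < N\<close> keeps the whole shifted support inside the window.\<close>

lemma sum_shift_reindex:
  fixes g :: "nat \<Rightarrow> complex"
  assumes "a + d < N" "\<And>s. s > d \<Longrightarrow> g s = 0"
  shows "(\<Sum>t<N. if a \<le> t then g (t - a) * w ^ t else 0) = w ^ a * (\<Sum>s\<le>d. g s * w ^ s)"
proof -
  have "(\<Sum>t<N. if a \<le> t then g (t - a) * w ^ t else 0) = (\<Sum>t\<in>{a..a+d}. g (t - a) * w ^ t)"
    by (rule sum.mono_neutral_cong_right) (use assms in \<open>auto simp: not_le less_diff_conv\<close>)
  also have "\<dots> = (\<Sum>s\<le>d. g s * w ^ (a + s))"
    by (rule sum.reindex_bij_witness[where i = "\<lambda>s. a + s" and j = "\<lambda>t. t - a"]) auto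
  finally show ?thesis by (simp add: sum_distrib_left power_add mult_ac)
qed

text \<open>Reflection about \<open>a\<close> replaces \<open>w\<close> by its inverse
  \<open>w'\<close>. The condition \<open>d \<le> a\<close> keeps the reflected support within the
  natural numbers.\<close>

lemma sum_reflect_reindex:
  fixes g :: "nat \<Rightarrow> complex"
  assumes "d \<le> a" "a < N" "\<And>s. s > d \<Longrightarrow> g s = 0" "w * w' = 1"
  shows "(\<Sum>t<N. if t \<le> a then g (a - t) * w ^ t else 0) = w ^ a * (\<Sum>s\<le>d. g s * w' ^ s)"
proof -
  have "(\<Sum>t<N. if t \<le> a then g (a - t) * w ^ t else 0) = (\<Sum>t\<in>{a-d..a}. g (a - t) * w ^ t)"
    by (rule sum.mono_neutral_cong_right) (use assms in \<open>auto simp: not_le\<close>)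
  also have "\<dots> = (\<Sum>s\<le>d. g s * w ^ (a - s))"
    by (rule sum.reindex_bij_witness[where i = "\<lambda>s. a - s" and j = "\<lambda>t. a - t"]) (use assms in auto)
  also have "\<dots> = (\<Sum>s\<le>d. w ^ a * (g s * w' ^ s))"
  proof (rule sum.cong[OF refl])
    fix s assume "s \<in> {..d}"
    then have "w ^ a = w ^ (a - s) * w ^ s" using assms by (simp flip: power_add)
    moreover have "w ^ s * w' ^ s = 1" using assms(4) by (simp flip: power_mult_distrib)
    ultimately show "g s * w ^ (a - s) = w ^ a * (g s * w' ^ s)" by (simp add: mult_ac)
  qed
  finally show ?thesis by (simp add: sum_distrib_left)
qed

text \<open>On the unit circle the two convolutions multiply the transform of \<open>y\<close> by
  the symbol and by its conjugate, because \<open>c\<close> is real. The difference of these factors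
  is twice the imaginary part, hence at most 2\<eta> times the modulus of the symbol, and Parseval
  carries this pointwise bound over to sums of squares.\<close>

lemma anticausal_convolution_close:
  fixes c y :: "nat \<Rightarrow> real" and \<eta> :: real
  assumes c0: "\<And>s. s > d \<Longrightarrow> c s = 0"
    and cone: "\<And>w. cmod w = 1 \<Longrightarrow>
      \<bar>Im (\<Sum>s\<le>d. of_real (c s) * w ^ s)\<bar> \<le> \<eta> * cmod (\<Sum>s\<le>d. of_real (c s) * w ^ s)"
  shows "(\<Sum>j<n+d. ((\<Sum>k<n. if k \<le> j then y k * c (j - k) else 0)
                   - (\<Sum>k<n. if j \<le> k then y k * c (k - j) else 0))\<^sup>2)
     \<le> 4 * \<eta>\<^sup>2 * (\<Sum>j<n+d. (\<Sum>k<n. if k \<le> j then y k * c (j - k) else 0)\<^sup>2)"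
proof -
  \<comment> \<open>The anticausal convolution reaches down to index -d. Below, \<open>f\<close> and
    \<open>g\<close> are \<open>X\<close> and \<open>H\<close> shifted by \<open>d\<close>, and a
    window of length n + 2d contains both supports.\<close>
  define N where "N = n + 2 * d"
  define X where "X j = (\<Sum>k<n. if k \<le> j then y k * c (j - k) else 0)" for j
  define H where "H j = (\<Sum>k<n. if j \<le> k then y k * c (k - j) else 0)" for j
  define f where "f t = (\<Sum>k<n. if k + d \<le> t then y k * c (t - (k + d)) else 0)" for t
  define g where "g t = (\<Sum>k<n. if t \<le> k + d then y k * c (k + d - t) else 0)" for t
  define \<phi> where "\<phi> w = (\<Sum>s\<le>d. complex_of_real (c s) * w ^ s)" for w
  have fX: "f (j + d) = X j" for j unfolding f_def X_def by (intro sum.cong) auto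
  have gH: "g (j + d) = H j" for j unfolding g_def H_def by (intro sum.cong) auto
  have f0: "f t = 0" if "t < d" for t unfolding f_def using that by (intro sum.neutral) auto
  have F: "(\<Sum>t<N. of_real (f t) * w ^ t) = w ^ d * (\<Sum>k<n. of_real (y k) * w ^ k) * \<phi> w" for w
  proof -
    have "(\<Sum>t<N. of_real (f t) * w ^ t)
      = (\<Sum>t<N. \<Sum>k<n. of_real (y k) * (if k + d \<le> t then of_real (c (t - (k + d))) * w ^ t else 0))"
      unfolding f_def of_real_sum sum_distrib_right by (intro sum.cong refl) auto
    also have "\<dots> = (\<Sum>k<n. of_real (y k) *
        (\<Sum>t<N. if k + d \<le> t then of_real (c (t - (k + d))) * w ^ t else 0))"
      by (subst sum.swap) (simp only: sum_distrib_left)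
    also have "\<dots> = (\<Sum>k<n. of_real (y k) * (w ^ (k + d) * \<phi> w))"
      unfolding \<phi>_def
      by (intro sum.cong refl arg_cong2[where f = "(*)"] sum_shift_reindex) (auto simp: N_def c0)
    finally show ?thesis by (simp add: sum_distrib_left sum_distrib_right power_add mult_ac)
  qed
  have G: "(\<Sum>t<N. of_real (g t) * w ^ t) = w ^ d * (\<Sum>k<n. of_real (y k) * w ^ k) * \<phi> (cnj w)"
    if "cmod w = 1" for w
  proof -
    have w1: "w * cnj w = 1" using that by (simp flip: complex_norm_square)
    have "(\<Sum>t<N. of_real (g t) * w ^ t)
      = (\<Sum>t<N. \<Sum>k<n. of_real (y k) * (if t \<le> k + d then of_real (c (k + d - t)) * w ^ t else 0))"
      unfolding g_def of_real_sum sum_distrib_right by (intro sum.cong refl) auto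
    also have "\<dots> = (\<Sum>k<n. of_real (y k) *
        (\<Sum>t<N. if t \<le> k + d then of_real (c (k + d - t)) * w ^ t else 0))"
      by (subst sum.swap) (simp only: sum_distrib_left)
    also have "\<dots> = (\<Sum>k<n. of_real (y k) * (w ^ (k + d) * \<phi> (cnj w)))"
      unfolding \<phi>_def
      by (intro sum.cong refl arg_cong2[where f = "(*)"] sum_reflect_reindex) (auto simp: N_def c0 w1)
    finally show ?thesis by (simp add: sum_distrib_left sum_distrib_right power_add mult_ac)
  qed
  have \<phi>_cnj: "\<phi> (cnj w) = cnj (\<phi> w)" for w unfolding \<phi>_def by simp
  have pointwise: "(cmod (\<Sum>t<N. of_real (f t - g t) * w ^ t))\<^sup>2
      \<le> 4 * \<eta>\<^sup>2 * (cmod (\<Sum>t<N. of_real (f t) * w ^ t))\<^sup>2" if "cmod w = 1" for w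
  proof -
    define p where "p = w ^ d * (\<Sum>k<n. of_real (y k) * w ^ k)"
    have "(\<Sum>t<N. of_real (f t - g t) * w ^ t) = p * (\<phi> w - cnj (\<phi> w))"
      using F[of w] G[OF that] by (simp add: p_def sum_subtractf algebra_simps \<phi>_cnj)
    moreover have "cmod (\<phi> w - cnj (\<phi> w)) = 2 * \<bar>Im (\<phi> w)\<bar>"
      by (simp add: complex_diff_cnj norm_mult)
    ultimately have "cmod (\<Sum>t<N. of_real (f t - g t) * w ^ t) = cmod p * (2 * \<bar>Im (\<phi> w)\<bar>)"
      by (simp only: norm_mult)
    also have "\<dots> \<le> cmod p * (2 * (\<eta> * cmod (\<phi> w)))"
      using cone[OF that] unfolding \<phi>_def by (intro mult_left_mono) auto
    finally have "(cmod (\<Sum>t<N. of_real (f t - g t) * w ^ t))\<^sup>2 \<le> (cmod p * (2 * (\<eta> * cmod (\<phi> w))))\<^sup>2"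
      by (intro power_mono) auto
    then show ?thesis
      using F[of w] by (simp add: p_def norm_mult power_mult_distrib mult_ac)
  qed
  have "real N * (\<Sum>t<N. (f t - g t)\<^sup>2) \<le> 4 * \<eta>\<^sup>2 * (real N * (\<Sum>t<N. (f t)\<^sup>2))"
    unfolding finite_parseval[symmetric] sum_distrib_left[of "4 * \<eta>\<^sup>2"]
    by (intro sum_mono pointwise) simp
  then have main: "(\<Sum>t<N. (f t - g t)\<^sup>2) \<le> 4 * \<eta>\<^sup>2 * (\<Sum>t<N. (f t)\<^sup>2)"
    by (cases "N = 0") (auto simp: mult.left_commute[of _ "real N"])
  have shift: "(\<Sum>j<n+d. u (j + d)) = (\<Sum>t\<in>{d..<N}. u t)" for u :: "nat \<Rightarrow> real"
    by (rule sum.reindex_bij_witness[where i = "\<lambda>t. t - d" and j = "\<lambda>j. j + d"]) (auto simp: N_def)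
  have "(\<Sum>j<n+d. (X j - H j)\<^sup>2) = (\<Sum>t\<in>{d..<N}. (f t - g t)\<^sup>2)"
    using shift[of "\<lambda>t. (f t - g t)\<^sup>2"] by (simp add: fX gH)
  \<comment> \<open>Restoring the indices below \<open>d\<close> only enlarges the left side, while
    on the right side \<open>f\<close> vanishes there.\<close>
  also have "\<dots> \<le> (\<Sum>t<N. (f t - g t)\<^sup>2)" by (rule sum_mono2) auto
  also note main
  also have "(\<Sum>t<N. (f t)\<^sup>2) = (\<Sum>t\<in>{d..<N}. (f t)\<^sup>2)"
    by (rule sum.mono_neutral_right) (auto simp: f0)
  also have "\<dots> = (\<Sum>j<n+d. (X j)\<^sup>2)"
    using shift[of "\<lambda>t. (f t)\<^sup>2"] by (simp add: fX)
  finally show ?thesis by (simp add: X_def H_def)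
qed

section \<open>Galerkin solutions\<close>

text \<open>Column \<open>k\<close> of \<open>Y\<close> is the Galerkin solution on coordinates 0 to
  k. Stability needs columns with the triangular support, which causal convolution preserves; the
  equations survive anticausal convolution. The closeness of the two convolutions makes both
  available at once.\<close>

lemma galerkin_diagonal_bound:
  fixes A Y :: "nat \<Rightarrow> nat \<Rightarrow> real" and z :: "nat \<Rightarrow> real"
  assumes e: "0 < e" "e < 1 / 2" "256 * C\<^sup>2 * e\<^sup>2 \<le> \<gamma>\<^sup>2" and \<gamma>: "\<gamma> > 0"
    and bounded: "\<And>x. (\<Sum>l<n. (\<Sum>i<n. A l i * x i)\<^sup>2) \<le> C\<^sup>2 * (\<Sum>i<n. (x i)\<^sup>2)"
    and sections: "\<And>x k. k \<le> n \<Longrightarrow> \<gamma>\<^sup>2 * (\<Sum>i<k. (x i)\<^sup>2) \<le> (\<Sum>l<k. (\<Sum>i<k. A l i * x i)\<^sup>2)"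
    and upper: "\<And>i k. k < i \<Longrightarrow> Y i k = 0"
    and galerkin: "\<And>l k. l \<le> k \<Longrightarrow> k < n \<Longrightarrow> (\<Sum>i<n. A l i * Y i k) = z l"
  shows "(\<Sum>j<n. (Y j j)\<^sup>2)
    \<le> 8 / (\<gamma>\<^sup>2 * (1 - 2 * e)) * real n powr (1 - 2 * e) * (\<Sum>l<n. (z l)\<^sup>2)"
proof (cases "n = 0")
  case False
  obtain d c where c: "c 0 = (1::real)" "\<And>s. s > d \<Longrightarrow> c s = 0"
    and csum: "(\<Sum>m<n. (\<Sum>k\<le>m. c k)\<^sup>2) \<le> 2 / (1 - 2 * e) * real n powr (1 - 2 * e)"
    and cone: "\<And>w. cmod w = 1 \<Longrightarrow> \<bar>Im (\<Sum>s\<le>d. of_real (c s) * w ^ s)\<bar>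
            \<le> 4 * e * cmod (\<Sum>s\<le>d. of_real (c s) * w ^ s)"
    using small_argument_polynomial[of e n] e False by auto
  define X where "X i j = (\<Sum>k<n. if k \<le> j then Y i k * c (j - k) else 0)" for i j
  define H where "H i j = (\<Sum>k<n. if j \<le> k then Y i k * c (k - j) else 0)" for i j
  define q where "q j = (\<Sum>k<n. if j \<le> k then c (k - j) else 0)" for j
  define Z where "Z = (\<Sum>l<n. (z l)\<^sup>2)"
  define XX where "XX = (\<Sum>j<n+d. \<Sum>i<n. (X i j)\<^sup>2)"
  have Z0: "Z \<ge> 0" by (simp add: Z_def sum_nonneg)
  have XX0: "XX \<ge> 0" by (simp add: XX_def sum_nonneg)
  have X0: "X i j = 0" if "j < i" for i j
    unfolding X_def using that by (intro sum.neutral) (auto simp: upper)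
  have X_diag: "X j j = Y j j" if "j < n" for j
  proof -
    have "X j j = (\<Sum>k<n. if k = j then Y j j else 0)"
      unfolding X_def by (intro sum.cong refl) (auto simp: upper c)
    then show ?thesis using that by simp
  qed
  \<comment> \<open>All columns \<open>k\<close> entering \<open>H i j\<close> satisfy
    \<open>l \<le> j \<le> k\<close>, so the Galerkin equation of row \<open>l\<close> applies to
    each of them and only the coefficient sum \<open>q j\<close> remains.\<close>
  have AH: "(\<Sum>i<n. A l i * H i j) = q j * z l" if "l \<le> j" for l j
  proof -
    have "(\<Sum>i<n. A l i * H i j) = (\<Sum>i<n. \<Sum>k<n. (if j \<le> k then c (k - j) else 0) * (A l i * Y i k))"
      unfolding H_def sum_distrib_left by (intro sum.cong refl) auto
    also have "\<dots> = (\<Sum>k<n. (if j \<le> k then c (k - j) else 0) * (\<Sum>i<n. A l i * Y i k))"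
      by (subst sum.swap) (simp only: sum_distrib_left)
    also have "\<dots> = (\<Sum>k<n. (if j \<le> k then c (k - j) else 0) * z l)"
      using that by (intro sum.cong refl) (auto simp: galerkin)
    finally show ?thesis by (simp add: q_def sum_distrib_right)
  qed
  \<comment> \<open>Only the columns below \<open>n\<close> exist, so the coefficient sum stops at n
    - 1 - j; reversing the order of \<open>j\<close> yields exactly the partial sums controlled by
    \<open>csum\<close>.\<close>
  have q_eq: "q j = (if j < n then \<Sum>k\<le>n - Suc j. c k else 0)" for j
  proof (cases "j < n")
    case True
    have "q j = (\<Sum>k\<in>{j..<n}. c (k - j))"
      unfolding q_def by (rule sum.mono_neutral_cong_right) auto
    also have "\<dots> = (\<Sum>k\<le>n - Suc j. c k)"
      by (rule sum.reindex_bij_witness[where i = "\<lambda>k. k + j" and j = "\<lambda>k. k - j"]) (use True in auto)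
    finally show ?thesis using True by simp
  qed (auto simp: q_def intro: sum.neutral)
  have "(\<Sum>j<n+d. (q j)\<^sup>2) = (\<Sum>j<n. (\<Sum>k\<le>n - Suc j. c k)\<^sup>2)"
    by (rule sum.mono_neutral_cong_right) (auto simp: q_eq)
  also have "\<dots> = (\<Sum>m<n. (\<Sum>k\<le>m. c k)\<^sup>2)"
    by (rule sum.nat_diff_reindex)
  finally have qsum: "(\<Sum>j<n+d. (q j)\<^sup>2) \<le> 2 / (1 - 2 * e) * real n powr (1 - 2 * e)"
    using csum by simp
  have column: "\<gamma>\<^sup>2 * (\<Sum>i<n. (X i j)\<^sup>2) \<le> 2 * Z * (q j)\<^sup>2 + 2 * C\<^sup>2 * (\<Sum>i<n. (X i j - H i j)\<^sup>2)" for j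
  proof -
    \<comment> \<open>Causal convolution also produces columns with \<open>j \<ge> n\<close>; for
      these the full section is used.\<close>
    define k where "k = min (Suc j) n"
    have kn: "k \<le> n" by (simp add: k_def)
    have Xk: "(\<Sum>i<k. f i (X i j)) = (\<Sum>i<n. f i (X i j))" if "\<And>i. f i 0 = 0" for f :: "nat \<Rightarrow> real \<Rightarrow> real"
      using kn by (intro sum.mono_neutral_left) (auto simp: k_def X0 that)
    have "\<gamma>\<^sup>2 * (\<Sum>i<n. (X i j)\<^sup>2) = \<gamma>\<^sup>2 * (\<Sum>i<k. (X i j)\<^sup>2)"
      using Xk[of "\<lambda>i x. x\<^sup>2"] by simp
    also have "\<dots> \<le> (\<Sum>l<k. (\<Sum>i<k. A l i * X i j)\<^sup>2)" by (rule sections[OF kn])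
    also have "\<dots> = (\<Sum>l<k. (\<Sum>i<n. A l i * X i j)\<^sup>2)"
      using Xk[of "\<lambda>i x. A l i * x" for l] by simp
    also have "\<dots> = (\<Sum>l<k. (q j * z l + (\<Sum>i<n. A l i * (X i j - H i j)))\<^sup>2)"
    proof (intro sum.cong refl)
      fix l assume "l \<in> {..<k}"
      then have "l \<le> j" by (auto simp: k_def)
      then show "(\<Sum>i<n. A l i * X i j)\<^sup>2 = (q j * z l + (\<Sum>i<n. A l i * (X i j - H i j)))\<^sup>2"
        using AH[of l j] by (simp add: right_diff_distrib sum_subtractf)
    qed
    also have "\<dots> \<le> (\<Sum>l<k. 2 * (q j * z l)\<^sup>2 + 2 * (\<Sum>i<n. A l i * (X i j - H i j))\<^sup>2)"
    proof (rule sum_mono)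
      fix l
      show "(q j * z l + (\<Sum>i<n. A l i * (X i j - H i j)))\<^sup>2
          \<le> 2 * (q j * z l)\<^sup>2 + 2 * (\<Sum>i<n. A l i * (X i j - H i j))\<^sup>2"
        using sum_squares_bound[of "q j * z l" "\<Sum>i<n. A l i * (X i j - H i j)"]
        unfolding power2_sum by linarith
    qed
    also have "\<dots> \<le> (\<Sum>l<n. 2 * (q j * z l)\<^sup>2 + 2 * (\<Sum>i<n. A l i * (X i j - H i j))\<^sup>2)"
      using kn by (intro sum_mono2) auto
    also have "\<dots> = 2 * Z * (q j)\<^sup>2 + 2 * (\<Sum>l<n. (\<Sum>i<n. A l i * (X i j - H i j))\<^sup>2)"
      by (simp add: Z_def sum.distrib sum_distrib_left sum_distrib_right power_mult_distrib mult_ac)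
    also have "\<dots> \<le> 2 * Z * (q j)\<^sup>2 + 2 * (C\<^sup>2 * (\<Sum>i<n. (X i j - H i j)\<^sup>2))"
      using bounded[of "\<lambda>i. X i j - H i j"] by simp
    finally show ?thesis by simp
  qed
  have "\<gamma>\<^sup>2 * XX \<le> (\<Sum>j<n+d. 2 * Z * (q j)\<^sup>2 + 2 * C\<^sup>2 * (\<Sum>i<n. (X i j - H i j)\<^sup>2))"
    unfolding XX_def sum_distrib_left[of "\<gamma>\<^sup>2" _ "{..<n+d}"] by (intro sum_mono column)
  also have "\<dots> = 2 * Z * (\<Sum>j<n+d. (q j)\<^sup>2) + 2 * C\<^sup>2 * (\<Sum>j<n+d. \<Sum>i<n. (X i j - H i j)\<^sup>2)"
    by (simp only: sum.distrib sum_distrib_left)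
  also have "(\<Sum>j<n+d. \<Sum>i<n. (X i j - H i j)\<^sup>2) = (\<Sum>i<n. \<Sum>j<n+d. (X i j - H i j)\<^sup>2)"
    by (rule sum.swap)
  also have "\<dots> \<le> (\<Sum>i<n. 4 * (4 * e)\<^sup>2 * (\<Sum>j<n+d. (X i j)\<^sup>2))"
    unfolding X_def H_def by (intro sum_mono anticausal_convolution_close c cone)
  also have "\<dots> = 4 * (4 * e)\<^sup>2 * XX"
    unfolding XX_def by (subst sum.swap) (simp only: sum_distrib_left)
  finally have "\<gamma>\<^sup>2 * XX \<le> 2 * Z * (\<Sum>j<n+d. (q j)\<^sup>2) + 2 * C\<^sup>2 * (4 * (4 * e)\<^sup>2 * XX)"
    by (simp add: mult_left_mono)
  \<comment> \<open>The hypothesis on \<open>e\<close> is made for this absorption: the error is at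
    most half of the left side.\<close>
  also have "2 * C\<^sup>2 * (4 * (4 * e)\<^sup>2 * XX) = (256 * C\<^sup>2 * e\<^sup>2) * XX / 2"
    by (simp add: power2_eq_square)
  also have "\<dots> \<le> \<gamma>\<^sup>2 * XX / 2"
    using e(3) XX0 by (intro divide_right_mono mult_right_mono) auto
  finally have "\<gamma>\<^sup>2 * XX \<le> 4 * Z * (\<Sum>j<n+d. (q j)\<^sup>2)" by simp
  also have "\<dots> \<le> 4 * Z * (2 / (1 - 2 * e) * real n powr (1 - 2 * e))"
    using Z0 by (intro mult_left_mono qsum) auto
  finally have "XX * \<gamma>\<^sup>2 \<le> 4 * Z * (2 / (1 - 2 * e) * real n powr (1 - 2 * e))"
    by (simp only: mult.commute[of XX])
  then have "XX \<le> 4 * Z * (2 / (1 - 2 * e) * real n powr (1 - 2 * e)) / \<gamma>\<^sup>2"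
    by (rule mult_imp_le_div_pos[rotated]) (use \<gamma> in simp)
  also have "\<dots> = 8 / (\<gamma>\<^sup>2 * (1 - 2 * e)) * real n powr (1 - 2 * e) * Z"
    by (simp add: mult_ac)
  finally have "XX \<le> \<dots>" .
  moreover have "(\<Sum>j<n. (Y j j)\<^sup>2) \<le> XX"
  proof -
    have "(\<Sum>j<n. (Y j j)\<^sup>2) = (\<Sum>j<n. (X j j)\<^sup>2)" by (simp add: X_diag)
    also have "\<dots> \<le> (\<Sum>j<n. \<Sum>i<n. (X i j)\<^sup>2)"
      by (intro sum_mono member_le_sum[where f = "\<lambda>i. (X i _)\<^sup>2"]) auto
    also have "\<dots> \<le> XX" unfolding XX_def by (intro sum_mono2) (auto simp: sum_nonneg)
    finally show ?thesis .
  qed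
  ultimately show ?thesis by (simp add: Z_def)
qed simp

section \<open>The spectral norm\<close>

lemma vec_l2_nonneg: "0 \<le> vec_l2 v"
  by (simp add: vec_l2_def sum_nonneg)

lemma vec_l2_power2: "(vec_l2 v)\<^sup>2 = (\<Sum>i<dim_vec v. (vec_index v i)\<^sup>2)"
  by (simp add: vec_l2_def sum_nonneg)

lemma vec_l2_smult: "vec_l2 (a \<cdot>\<^sub>v v) = \<bar>a\<bar> * vec_l2 v"
  by (simp add: vec_l2_def power_mult_distrib real_sqrt_mult flip: sum_distrib_left)

lemma vec_l2_zero: "vec_l2 (0\<^sub>v n) = 0"
  by (simp add: vec_l2_def)

lemma vec_l2_eq_0D: "v \<in> carrier_vec n \<Longrightarrow> vec_l2 v = 0 \<Longrightarrow> v = 0\<^sub>v n"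
  by (intro eq_vecI) (auto simp: vec_l2_def sum_nonneg sum_nonneg_eq_0_iff)

lemma scalar_prod_le_vec_l2:
  assumes "v \<in> carrier_vec n" "w \<in> carrier_vec n"
  shows "\<bar>v \<bullet> w\<bar> \<le> vec_l2 v * vec_l2 w"
proof -
  have "(v \<bullet> w)\<^sup>2 \<le> (vec_l2 v * vec_l2 w)\<^sup>2"
    using assms Cauchy_Schwarz_ineq_sum[of "vec_index v" "vec_index w" "{..<n}"]
    by (simp add: scalar_prod_def power_mult_distrib vec_l2_power2 atLeast0LessThan)
  then show ?thesis
    using abs_le_square_iff[of "v \<bullet> w" "vec_l2 v * vec_l2 w"] by (simp add: vec_l2_nonneg abs_mult)
qed

lemma mult_mat_vec_nth:
  assumes "A \<in> carrier_mat n m" "v \<in> carrier_vec m" "i < n"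
  shows "vec_index (A *\<^sub>v v) i = (\<Sum>j<m. A $$ (i,j) * vec_index v j)"
  using assms by (simp add: scalar_prod_def atLeast0LessThan)

lemma mult_mat_nth:
  assumes "A \<in> carrier_mat n m" "B \<in> carrier_mat m k" "i < n" "j < k"
  shows "(A * B) $$ (i,j) = (\<Sum>l<m. A $$ (i,l) * B $$ (l,j))"
  using assms by (simp add: scalar_prod_def atLeast0LessThan)

text \<open>The supremum is usable only once its set is known to be bounded; Cauchy-Schwarz on the
  rows gives the Frobenius norm as a bound. The claim then follows by scaling \<open>v\<close> to
  unit length.\<close>

lemma vec_l2_mult_le_spec_norm:
  assumes A: "A \<in> carrier_mat n m" and v: "v \<in> carrier_vec m"
  shows "vec_l2 (A *\<^sub>v v) \<le> spec_norm A * vec_l2 v"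
proof (cases "vec_l2 v = 0")
  case True
  then have "v = 0\<^sub>v m" using v by (rule vec_l2_eq_0D[rotated])
  then have "A *\<^sub>v v = 0\<^sub>v n" using A by (intro eq_vecI) (auto simp: scalar_prod_def)
  then show ?thesis using True by (simp add: vec_l2_zero)
next
  case False
  then have pos: "vec_l2 v > 0" using vec_l2_nonneg[of v] by linarith
  define S where "S = {vec_l2 (A *\<^sub>v u) | u. u \<in> carrier_vec (dim_col A) \<and> vec_l2 u \<le> 1}"
  have "vec_l2 (A *\<^sub>v u) \<le> sqrt (\<Sum>i<n. (vec_l2 (Matrix.row A i))\<^sup>2)"
    if u: "u \<in> carrier_vec m" "vec_l2 u \<le> 1" for u
  proof -
    have "(vec_index (A *\<^sub>v u) i)\<^sup>2 \<le> (vec_l2 (Matrix.row A i))\<^sup>2" if "i < n" for i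
    proof -
      have "\<bar>Matrix.row A i \<bullet> u\<bar> \<le> vec_l2 (Matrix.row A i) * vec_l2 u"
        using A u by (intro scalar_prod_le_vec_l2[of _ m]) auto
      also have "\<dots> \<le> vec_l2 (Matrix.row A i) * 1"
        using u by (intro mult_left_mono vec_l2_nonneg)
      finally have "\<bar>Matrix.row A i \<bullet> u\<bar> \<le> \<bar>vec_l2 (Matrix.row A i)\<bar>" by simp
      then show ?thesis using that A unfolding abs_le_square_iff by simp
    qed
    then show ?thesis
      unfolding vec_l2_def[of "A *\<^sub>v u"] using A by (intro real_sqrt_le_mono) (auto intro: sum_mono)
  qed
  then have bdd: "bdd_above S" unfolding S_def using A by (intro bdd_aboveI) auto
  define u where "u = (1 / vec_l2 v) \<cdot>\<^sub>v v"
  have u: "u \<in> carrier_vec m" "vec_l2 u \<le> 1" using v pos by (auto simp: u_def vec_l2_smult)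
  then have "vec_l2 (A *\<^sub>v u) \<in> S" using A by (auto simp: S_def)
  then have "vec_l2 (A *\<^sub>v u) \<le> spec_norm A"
    using cSup_upper[OF _ bdd] by (simp add: spec_norm_def S_def)
  moreover have "A *\<^sub>v u = (1 / vec_l2 v) \<cdot>\<^sub>v (A *\<^sub>v v)"
    unfolding u_def using A v by (rule mult_mat_vec)
  ultimately show ?thesis using pos by (simp add: vec_l2_smult field_simps)
qed

lemma spec_norm_leI:
  assumes A: "A \<in> carrier_mat n m" and b: "b \<ge> 0"
    and le: "\<And>v. v \<in> carrier_vec m \<Longrightarrow> vec_l2 (A *\<^sub>v v) \<le> b * vec_l2 v"
  shows "spec_norm A \<le> b"
  unfolding spec_norm_def
proof (rule cSup_least)
  have "0\<^sub>v m \<in> carrier_vec (dim_col A) \<and> vec_l2 (0\<^sub>v m) \<le> 1" using A by (simp add: vec_l2_zero)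
  then show "{vec_l2 (A *\<^sub>v v) | v. v \<in> carrier_vec (dim_col A) \<and> vec_l2 v \<le> 1} \<noteq> {}" by blast
next
  fix x assume "x \<in> {vec_l2 (A *\<^sub>v v) | v. v \<in> carrier_vec (dim_col A) \<and> vec_l2 v \<le> 1}"
  then obtain v where v: "v \<in> carrier_vec m" "vec_l2 v \<le> 1" "x = vec_l2 (A *\<^sub>v v)" using A by auto
  then have "x \<le> b * vec_l2 v" using le by simp
  also have "\<dots> \<le> b * 1" using v b by (intro mult_left_mono)
  finally show "x \<le> b" by simp
qed

section \<open>Products and transposes\<close>

lemma spec_norm_mult_le:
  assumes A: "A \<in> carrier_mat n m" and B: "B \<in> carrier_mat m k"
    and a: "spec_norm A \<le> a" "a \<ge> 0" and b: "spec_norm B \<le> b" "b \<ge> 0"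
  shows "spec_norm (A * B) \<le> a * b"
proof (rule spec_norm_leI)
  show "A * B \<in> carrier_mat n k" using A B by simp
  show "a * b \<ge> 0" using a b by simp
  fix v :: "real Matrix.vec" assume v: "v \<in> carrier_vec k"
  have "vec_l2 (A *\<^sub>v (B *\<^sub>v v)) \<le> spec_norm A * vec_l2 (B *\<^sub>v v)"
    using A B v by (intro vec_l2_mult_le_spec_norm) auto
  also have "\<dots> \<le> a * (b * vec_l2 v)"
  proof (intro mult_mono)
    have "vec_l2 (B *\<^sub>v v) \<le> spec_norm B * vec_l2 v" by (rule vec_l2_mult_le_spec_norm[OF B v])
    also have "\<dots> \<le> b * vec_l2 v" using b by (intro mult_right_mono vec_l2_nonneg)
    finally show "vec_l2 (B *\<^sub>v v) \<le> b * vec_l2 v" .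
  qed (use a vec_l2_nonneg in auto)
  finally show "vec_l2 (A * B *\<^sub>v v) \<le> a * b * vec_l2 v" using A B v by simp
qed

text \<open>For w the transpose of A applied to v, |w|^2 is the scalar product of v with A w, hence
  at most |v| a |w|; one factor |w| cancels.\<close>

lemma spec_norm_transpose_le:
  assumes A: "A \<in> carrier_mat n m" and a: "spec_norm A \<le> a" "a \<ge> 0"
  shows "spec_norm (transpose_mat A) \<le> a"
proof (rule spec_norm_leI)
  show "transpose_mat A \<in> carrier_mat m n" using A by simp
  fix v :: "real Matrix.vec" assume v: "v \<in> carrier_vec n"
  define w where "w = transpose_mat A *\<^sub>v v"
  have w: "w \<in> carrier_vec m" using A v by (simp add: w_def)
  have "(vec_l2 w)\<^sup>2 = w \<bullet> w"
    unfolding vec_l2_power2 using w by (simp add: scalar_prod_def atLeast0LessThan power2_eq_square)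
  also have "\<dots> = v \<bullet> (A *\<^sub>v w)"
    unfolding w_def using A v w by (subst transpose_vec_mult_scalar) (auto simp: w_def)
  also have "\<dots> \<le> vec_l2 v * vec_l2 (A *\<^sub>v w)"
    using scalar_prod_le_vec_l2[of v n "A *\<^sub>v w"] A v w by simp
  also have "\<dots> \<le> vec_l2 v * (a * vec_l2 w)"
  proof (intro mult_left_mono vec_l2_nonneg)
    have "vec_l2 (A *\<^sub>v w) \<le> spec_norm A * vec_l2 w" by (rule vec_l2_mult_le_spec_norm[OF A w])
    also have "\<dots> \<le> a * vec_l2 w" using a by (intro mult_right_mono vec_l2_nonneg)
    finally show "vec_l2 (A *\<^sub>v w) \<le> a * vec_l2 w" .
  qed
  finally have "vec_l2 w * vec_l2 w \<le> (a * vec_l2 v) * vec_l2 w"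
    by (simp add: power2_eq_square mult_ac)
  then show "vec_l2 w \<le> a * vec_l2 v"
    using vec_l2_nonneg[of w] vec_l2_nonneg[of v] a
    by (cases "vec_l2 w = 0") (auto simp: mult_le_cancel_right)
qed (rule a)

section \<open>The triangular factors\<close>

text \<open>\<open>B\<close> selects the inverses of the leading sections. The hypotheses form a
  locale so that the results also apply to the transposed matrix.\<close>

locale stable_sections =
  fixes n :: nat and M :: "real mat" and B :: "nat \<Rightarrow> real mat" and C \<gamma> :: real
  assumes C: "C > 0" and \<gamma>: "\<gamma> > 0"
    and M: "M \<in> carrier_mat n n" and M_norm: "spec_norm M \<le> C"
    and B_inverse: "\<And>j. j \<in> {1..n} \<Longrightarrow> is_inverse_of (B j) (ul_sub M j)"
    and B_norm: "\<And>j. j \<in> {1..n} \<Longrightarrow> spec_norm (B j) \<le> 1 / \<gamma>"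
begin

lemma ul_sub_carrier: "ul_sub M k \<in> carrier_mat k k"
  by (simp add: ul_sub_def)

lemma B_carrier: "j \<in> {1..n} \<Longrightarrow> B j \<in> carrier_mat j j"
  using B_inverse[of j] by (simp add: is_inverse_of_def ul_sub_def)

lemma B_right: "j \<in> {1..n} \<Longrightarrow> ul_sub M j * B j = 1\<^sub>m j"
  using B_inverse[of j] by (simp add: is_inverse_of_def ul_sub_def inverts_mat_def)

lemma B_left: "j \<in> {1..n} \<Longrightarrow> B j * ul_sub M j = 1\<^sub>m j"
  using B_inverse[of j] B_carrier[of j] by (simp add: is_inverse_of_def inverts_mat_def)

lemma B_right_nth:
  assumes "k < n" "l \<le> k" "j \<le> k"
  shows "(\<Sum>i<Suc k. M $$ (l,i) * B (Suc k) $$ (i,j)) = (if l = j then 1 else 0)"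
proof -
  have "(\<Sum>i<Suc k. M $$ (l,i) * B (Suc k) $$ (i,j)) = (ul_sub M (Suc k) * B (Suc k)) $$ (l,j)"
    using assms B_carrier[of "Suc k"] ul_sub_carrier[of "Suc k"]
    by (subst mult_mat_nth) (auto simp: ul_sub_def)
  then show ?thesis using assms by (simp add: B_right)
qed

lemma B_left_nth:
  assumes "k < n" "l \<le> k" "j \<le> k"
  shows "(\<Sum>i<Suc k. B (Suc k) $$ (l,i) * M $$ (i,j)) = (if l = j then 1 else 0)"
proof -
  have "(\<Sum>i<Suc k. B (Suc k) $$ (l,i) * M $$ (i,j)) = (B (Suc k) * ul_sub M (Suc k)) $$ (l,j)"
    using assms B_carrier[of "Suc k"] ul_sub_carrier[of "Suc k"]
    by (subst mult_mat_nth) (auto simp: ul_sub_def)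
  then show ?thesis using assms by (simp add: B_left)
qed

lemma M_bounded: "(\<Sum>l<n. (\<Sum>i<n. M $$ (l,i) * x i)\<^sup>2) \<le> C\<^sup>2 * (\<Sum>i<n. (x i)\<^sup>2)"
proof -
  let ?v = "Matrix.vec n x"
  have "vec_l2 (M *\<^sub>v ?v) \<le> spec_norm M * vec_l2 ?v"
    by (rule vec_l2_mult_le_spec_norm[OF M]) simp
  also have "\<dots> \<le> C * vec_l2 ?v" using M_norm by (intro mult_right_mono vec_l2_nonneg)
  finally have "(vec_l2 (M *\<^sub>v ?v))\<^sup>2 \<le> (C * vec_l2 ?v)\<^sup>2" by (intro power_mono vec_l2_nonneg)
  moreover have "vec_index (M *\<^sub>v ?v) l = (\<Sum>i<n. M $$ (l,i) * x i)" if "l < n" for l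
    using that M by (subst mult_mat_vec_nth) auto
  ultimately show ?thesis using M by (simp add: power_mult_distrib vec_l2_power2)
qed

text \<open>The vector is recovered by applying \<open>B k\<close> to its image under the section,
  and \<open>B k\<close> has norm at most 1/\<gamma>. The case \<open>k = 0\<close> is an empty
  sum.\<close>

lemma sections_bounded_below:
  assumes "k \<le> n"
  shows "\<gamma>\<^sup>2 * (\<Sum>i<k. (x i)\<^sup>2) \<le> (\<Sum>l<k. (\<Sum>i<k. M $$ (l,i) * x i)\<^sup>2)"
proof (cases "k = 0")
  case False
  then have k: "k \<in> {1..n}" using assms by auto
  let ?v = "Matrix.vec k x" and ?A = "ul_sub M k"
  have "B k *\<^sub>v (?A *\<^sub>v ?v) = ?v"
    using assoc_mult_mat_vec[OF B_carrier[OF k] ul_sub_carrier, of ?v] by (simp add: B_left[OF k])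
  then have "vec_l2 ?v = vec_l2 (B k *\<^sub>v (?A *\<^sub>v ?v))" by (simp only:)
  also have "\<dots> \<le> spec_norm (B k) * vec_l2 (?A *\<^sub>v ?v)"
    by (intro vec_l2_mult_le_spec_norm[OF B_carrier[OF k]] mult_mat_vec_carrier[OF ul_sub_carrier]) simp
  also have "\<dots> \<le> 1 / \<gamma> * vec_l2 (?A *\<^sub>v ?v)"
    using B_norm[OF k] by (intro mult_right_mono vec_l2_nonneg)
  finally have "\<gamma> * vec_l2 ?v \<le> vec_l2 (?A *\<^sub>v ?v)" using \<gamma> by (simp add: field_simps)
  then have "(\<gamma> * vec_l2 ?v)\<^sup>2 \<le> (vec_l2 (?A *\<^sub>v ?v))\<^sup>2"
    using \<gamma> by (intro power_mono) (auto simp: vec_l2_nonneg)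
  moreover have "vec_index (?A *\<^sub>v ?v) l = (\<Sum>i<k. M $$ (l,i) * x i)" if "l < k" for l
    using that ul_sub_carrier by (subst mult_mat_vec_nth) (auto simp: ul_sub_def)
  ultimately show ?thesis by (simp add: power_mult_distrib vec_l2_power2 ul_sub_def)
qed simp

text \<open>The entry is the reciprocal of pivot \<open>k\<close>, so this bounds the pivot from
  above. If \<delta> is the last entry of the last column x of the inverse, the first k equations
  and stability of section k bound the rest of x by |\<delta>| C/\<gamma>. On the other hand M x has
  an entry 1, so C |x| \<ge> 1.\<close>

lemma pivot_bound:
  assumes "k < n"
  shows "1 \<le> C * (1 + C / \<gamma>) * \<bar>B (Suc k) $$ (k,k)\<bar>"
proof -
  define x where "x i = (if i < Suc k then B (Suc k) $$ (i,k) else 0)" for i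
  define \<delta> where "\<delta> = x k"
  have col: "(\<Sum>i<Suc k. M $$ (l,i) * x i) = (if l = k then 1 else 0)" if "l \<le> k" for l
    using B_right_nth[OF assms that, of k] by (simp add: x_def)
  have x_ext: "(\<Sum>i<n. f i * x i) = (\<Sum>i<Suc k. f i * x i)" for f
    by (rule sum.mono_neutral_right) (use assms in \<open>auto simp: x_def\<close>)
  have colM: "(\<Sum>l<n. (M $$ (l,k))\<^sup>2) \<le> C\<^sup>2"
    using M_bounded[of "\<lambda>i. if i = k then 1 else 0"] assms
    by (simp add: if_distrib[of "\<lambda>x. _ * x"] if_distrib[of "\<lambda>x. x\<^sup>2"] cong: if_cong)
  have "\<gamma>\<^sup>2 * (\<Sum>i<k. (x i)\<^sup>2) \<le> (\<Sum>l<k. (\<Sum>i<k. M $$ (l,i) * x i)\<^sup>2)"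
    using assms by (intro sections_bounded_below) simp
  also have "\<dots> = (\<Sum>l<k. \<delta>\<^sup>2 * (M $$ (l,k))\<^sup>2)"
  proof (intro sum.cong refl)
    fix l assume "l \<in> {..<k}"
    then have "(\<Sum>i<k. M $$ (l,i) * x i) = - (M $$ (l,k) * \<delta>)"
      using col[of l] by (simp add: \<delta>_def)
    then show "(\<Sum>i<k. M $$ (l,i) * x i)\<^sup>2 = \<delta>\<^sup>2 * (M $$ (l,k))\<^sup>2"
      by (simp add: power_mult_distrib)
  qed
  also have "\<dots> \<le> \<delta>\<^sup>2 * (\<Sum>l<n. (M $$ (l,k))\<^sup>2)"
    unfolding sum_distrib_left using assms by (intro sum_mono2) auto
  also have "\<dots> \<le> \<delta>\<^sup>2 * C\<^sup>2" by (intro mult_left_mono colM) simp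
  finally have head: "(\<Sum>i<k. (x i)\<^sup>2) \<le> \<delta>\<^sup>2 * (C / \<gamma>)\<^sup>2"
    using \<gamma> by (simp add: field_simps power_divide)
  have "1 = (\<Sum>i<n. M $$ (k,i) * x i)\<^sup>2" using col[of k] by (simp only: x_ext) simp
  also have "\<dots> \<le> (\<Sum>l<n. (\<Sum>i<n. M $$ (l,i) * x i)\<^sup>2)"
    by (rule member_le_sum[where f = "\<lambda>l. (\<Sum>i<n. M $$ (l,i) * x i)\<^sup>2"]) (use assms in auto)
  also have "\<dots> \<le> C\<^sup>2 * (\<Sum>i<n. (x i)\<^sup>2)" by (rule M_bounded)
  also have "(\<Sum>i<n. (x i)\<^sup>2) = (\<Sum>i<k. (x i)\<^sup>2) + \<delta>\<^sup>2"
    using x_ext[of x] by (simp add: power2_eq_square \<delta>_def)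
  also have "\<dots> \<le> \<delta>\<^sup>2 * (C / \<gamma>)\<^sup>2 + \<delta>\<^sup>2" using head by simp
  also have "\<dots> = \<delta>\<^sup>2 * (1 + (C / \<gamma>)\<^sup>2)" by (simp add: distrib_left)
  also have "\<dots> \<le> \<delta>\<^sup>2 * (1 + C / \<gamma>)\<^sup>2"
    using C \<gamma> by (intro mult_left_mono) (auto simp: power2_sum)
  finally have "1 \<le> C\<^sup>2 * (\<delta>\<^sup>2 * (1 + C / \<gamma>)\<^sup>2)"
    by (simp add: mult_left_mono)
  then have "1\<^sup>2 \<le> (C * (1 + C / \<gamma>) * \<bar>\<delta>\<bar>)\<^sup>2"
    by (simp add: power_mult_distrib mult_ac)
  then have "1 \<le> C * (1 + C / \<gamma>) * \<bar>\<delta>\<bar>"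
    by (rule power2_le_imp_le) (use C \<gamma> in auto)
  then show ?thesis by (simp add: \<delta>_def x_def)
qed

text \<open>The future inverse of the upper factor: column \<open>j\<close> is the last column of
  the inverse of section j + 1, padded with zeros.\<close>

definition X :: "real mat" where
  "X = Matrix.mat n n (\<lambda>(i,j). if i \<le> j then B (Suc j) $$ (i,j) else 0)"

lemma X_carrier: "X \<in> carrier_mat n n"
  by (simp add: X_def)

lemma sum_mult_X:
  assumes "j < n"
  shows "(\<Sum>i<n. f i * X $$ (i,j)) = (\<Sum>i<Suc j. f i * B (Suc j) $$ (i,j))"
  by (rule sum.mono_neutral_cong_right) (use assms in \<open>auto simp: X_def\<close>)

lemma MX_carrier: "M * X \<in> carrier_mat n n"
  using M X_carrier by simp

text \<open>On its first j + 1 rows, column \<open>j\<close> of \<open>M * X\<close> is the last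
  unit vector. Thus \<open>M * X\<close> is unit lower triangular and will serve as L.\<close>

lemma MX_nth:
  assumes "l \<le> j" "j < n"
  shows "(M * X) $$ (l,j) = (if l = j then 1 else 0)"
proof -
  have "(M * X) $$ (l,j) = (\<Sum>i<n. M $$ (l,i) * X $$ (i,j))"
    using assms by (intro mult_mat_nth[OF M X_carrier]) auto
  then show ?thesis using assms B_right_nth[of j l j] by (simp only: sum_mult_X)
qed

text \<open>The inverse of the last section inverts \<open>M\<close> itself, so
  \<open>X = B n * (M * X)\<close>. For \<open>n = 0\<close> there is no such section.\<close>

lemma X_norm:
  assumes "spec_norm (M * X) \<le> a" "a \<ge> 0"
  shows "spec_norm X \<le> a / \<gamma>"
proof (cases "n = 0")
  case True
  then show ?thesis using X_carrier assms \<gamma>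
    by (intro spec_norm_leI) (auto simp: vec_l2_def)
next
  case False
  then have n: "n \<in> {1..n}" by simp
  have Bn: "B n \<in> carrier_mat n n" by (rule B_carrier[OF n])
  have "ul_sub M n = M" using M by (auto simp: ul_sub_def)
  then have "B n * (M * X) = X"
    using B_left[OF n] X_carrier by (simp flip: assoc_mult_mat[OF Bn M X_carrier])
  moreover have "spec_norm (B n * (M * X)) \<le> 1 / \<gamma> * a"
    using \<gamma> assms by (intro spec_norm_mult_le[OF Bn MX_carrier] B_norm[OF n]) auto
  ultimately show ?thesis by simp
qed

end

section \<open>Transposition and the norm bound for the lower factor\<close>

lemma is_inverse_of_transpose:
  assumes "is_inverse_of B A"
  shows "is_inverse_of (transpose_mat B) (transpose_mat A)"
proof -
  define n where "n = dim_row A"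
  have A: "A \<in> carrier_mat n n" and B: "B \<in> carrier_mat n n"
    using assms by (auto simp: is_inverse_of_def n_def)
  have AB: "A * B = 1\<^sub>m n" and BA: "B * A = 1\<^sub>m n"
    using assms A B by (auto simp: is_inverse_of_def inverts_mat_def)
  have "transpose_mat A * transpose_mat B = 1\<^sub>m n" "transpose_mat B * transpose_mat A = 1\<^sub>m n"
    using A B AB BA by (auto simp flip: transpose_mult)
  then show ?thesis using A B by (auto simp: is_inverse_of_def inverts_mat_def)
qed

context stable_sections
begin

lemma ul_sub_transpose: "k \<le> n \<Longrightarrow> ul_sub (transpose_mat M) k = transpose_mat (ul_sub M k)"
  using M by (intro eq_matI) (auto simp: ul_sub_def)

text \<open>Sections, inverses and spectral norms all respect transposition. Statements about
  columns of the inverses thereby yield those about rows.\<close>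

lemma transpose_stable_sections:
  "stable_sections n (transpose_mat M) (\<lambda>j. transpose_mat (B j)) C \<gamma>"
proof
  show "is_inverse_of (transpose_mat (B j)) (ul_sub (transpose_mat M) j)" if "j \<in> {1..n}" for j
    using is_inverse_of_transpose[OF B_inverse[OF that]] that by (simp add: ul_sub_transpose)
  show "spec_norm (transpose_mat (B j)) \<le> 1 / \<gamma>" if "j \<in> {1..n}" for j
    using \<gamma> by (intro spec_norm_transpose_le[OF B_carrier[OF that]] B_norm[OF that]) simp
  show "spec_norm (transpose_mat M) \<le> C"
    using C by (intro spec_norm_transpose_le[OF M M_norm]) simp
qed (use C \<gamma> M in auto)

interpretation T: stable_sections n "transpose_mat M" "\<lambda>j. transpose_mat (B j)" C \<gamma>
  by (rule transpose_stable_sections)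

text \<open>The transpose is estimated. With z the transpose of M applied to v, entry
  \<open>j\<close> of the image of v is the last entry of the Galerkin solution for the transposed
  matrix on j + 1 coordinates with data z. The diagonal bound therefore applies, and |z| \<le> C |v|
  contributes the factor \<open>C\<close>.\<close>

lemma MX_norm:
  assumes e: "0 < e" "e < 1 / 2" "256 * C\<^sup>2 * e\<^sup>2 \<le> \<gamma>\<^sup>2"
  shows "spec_norm (M * X) \<le> C * sqrt (8 / (\<gamma>\<^sup>2 * (1 - 2 * e))) * real n powr (1 / 2 - e)"
proof -
  define K where "K = 8 / (\<gamma>\<^sup>2 * (1 - 2 * e))"
  define b where "b = C * sqrt K * real n powr (1 / 2 - e)"
  have K0: "K \<ge> 0" using e by (simp add: K_def)
  have b0: "b \<ge> 0" using C K0 by (simp add: b_def)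
  have b2: "b\<^sup>2 = K * real n powr (1 - 2 * e) * C\<^sup>2"
  proof -
    have "(real n powr (1 / 2 - e))\<^sup>2 = real n powr (1 - 2 * e)"
      by (simp add: power2_eq_square flip: powr_add)
    then show ?thesis using K0 by (simp add: b_def power_mult_distrib)
  qed
  have "spec_norm (transpose_mat (M * X)) \<le> b"
  proof (rule spec_norm_leI)
    show "transpose_mat (M * X) \<in> carrier_mat n n" using MX_carrier by simp
    show "b \<ge> 0" by (rule b0)
    fix v :: "real Matrix.vec" assume v: "v \<in> carrier_vec n"
    define z where "z = vec_index (transpose_mat M *\<^sub>v v)"
    \<comment> \<open>Column \<open>k\<close> is the transpose of \<open>B (Suc k)\<close> applied
      to the first k + 1 entries of \<open>z\<close>, padded with zeros.\<close>
    define Y where "Y i k = (if i \<le> k then \<Sum>l<Suc k. z l * B (Suc k) $$ (l,i) else 0)" for i k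
    have TX: "transpose_mat (M * X) *\<^sub>v v = transpose_mat X *\<^sub>v (transpose_mat M *\<^sub>v v)"
      using M X_carrier v by (simp add: transpose_mult[of _ n n])
    have diag: "vec_index (transpose_mat (M * X) *\<^sub>v v) j = Y j j" if "j < n" for j
    proof -
      have "vec_index (transpose_mat (M * X) *\<^sub>v v) j = (\<Sum>l<n. transpose_mat X $$ (j,l) * z l)"
        unfolding TX z_def using that M X_carrier v by (intro mult_mat_vec_nth) auto
      also have "\<dots> = (\<Sum>l<n. z l * X $$ (l,j))"
        using that X_carrier by (intro sum.cong refl) (auto simp: mult.commute)
      also have "\<dots> = Y j j" using that by (simp only: sum_mult_X Y_def) simp
      finally show ?thesis .
    qed
    have galerkin: "(\<Sum>i<n. transpose_mat M $$ (l,i) * Y i k) = z l" if "l \<le> k" "k < n" for l k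
    proof -
      have "(\<Sum>i<n. transpose_mat M $$ (l,i) * Y i k)
        = (\<Sum>i<Suc k. M $$ (i,l) * (\<Sum>p<Suc k. z p * B (Suc k) $$ (p,i)))"
        by (rule sum.mono_neutral_cong_right) (use that M in \<open>auto simp: Y_def\<close>)
      also have "\<dots> = (\<Sum>i<Suc k. \<Sum>p<Suc k. z p * (B (Suc k) $$ (p,i) * M $$ (i,l)))"
        unfolding sum_distrib_left by (intro sum.cong refl) (simp add: mult_ac)
      also have "\<dots> = (\<Sum>p<Suc k. z p * (\<Sum>i<Suc k. B (Suc k) $$ (p,i) * M $$ (i,l)))"
        by (subst sum.swap) (simp only: sum_distrib_left)
      also have "\<dots> = (\<Sum>p<Suc k. if p = l then z p else 0)"
        using that by (intro sum.cong refl) (simp add: B_left_nth del: sum.lessThan_Suc)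
      also have "\<dots> = z l" using that by (subst sum.delta) auto
      finally show ?thesis .
    qed
    have "(vec_l2 (transpose_mat (M * X) *\<^sub>v v))\<^sup>2 = (\<Sum>j<n. (Y j j)\<^sup>2)"
      using X_carrier by (simp add: vec_l2_power2 diag del: index_mult_mat_vec)
    also have "\<dots> \<le> K * real n powr (1 - 2 * e) * (\<Sum>l<n. (z l)\<^sup>2)"
      unfolding K_def
      by (rule galerkin_diagonal_bound[OF e \<gamma> T.M_bounded T.sections_bounded_below _ galerkin])
        (auto simp: Y_def)
    also have "(\<Sum>l<n. (z l)\<^sup>2) \<le> C\<^sup>2 * (vec_l2 v)\<^sup>2"
    proof -
      have "(\<Sum>l<n. (z l)\<^sup>2) = (\<Sum>l<n. (\<Sum>i<n. transpose_mat M $$ (l,i) * vec_index v i)\<^sup>2)"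
        unfolding z_def using M v
        by (intro sum.cong refl arg_cong[where f = "\<lambda>x. x\<^sup>2"] mult_mat_vec_nth) auto
      also have "\<dots> \<le> C\<^sup>2 * (\<Sum>i<n. (vec_index v i)\<^sup>2)" by (rule T.M_bounded)
      finally show ?thesis using v by (simp add: vec_l2_power2)
    qed
    finally have "(vec_l2 (transpose_mat (M * X) *\<^sub>v v))\<^sup>2 \<le> (b * vec_l2 v)\<^sup>2"
      using K0 by (simp add: b2 power_mult_distrib mult_left_mono mult.assoc)
    then show "vec_l2 (transpose_mat (M * X) *\<^sub>v v) \<le> b * vec_l2 v"
      by (rule power2_le_imp_le) (use b0 vec_l2_nonneg in auto)
  qed
  then have "spec_norm (transpose_mat (transpose_mat (M * X))) \<le> b"
    using spec_norm_transpose_le[of "transpose_mat (M * X)" n n b] MX_carrier b0 by simp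
  then show ?thesis by (simp add: b_def K_def)
qed

text \<open>Row \<open>i\<close> is the last row of \<open>B (Suc i)\<close>, padded with zeros: the
  inverse of L before its rows are scaled by the pivots.\<close>

definition W :: "real mat" where
  "W = transpose_mat (stable_sections.X n (\<lambda>j. transpose_mat (B j)))"

lemma W_carrier: "W \<in> carrier_mat n n"
  using T.X_carrier by (simp add: W_def)

lemma W_nth: "i < n \<Longrightarrow> j < n \<Longrightarrow> W $$ (i,j) = (if j \<le> i then B (Suc i) $$ (i,j) else 0)"
  using B_carrier[of "Suc i"] by (simp add: W_def T.X_def)

lemma WM_eq: "W * M = transpose_mat (transpose_mat M * T.X)"
  using M T.X_carrier by (simp add: W_def transpose_mult[of _ n n])

lemma WM_carrier: "W * M \<in> carrier_mat n n"
  using M W_carrier by simp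

lemma WM_nth:
  assumes "j \<le> i" "i < n"
  shows "(W * M) $$ (i,j) = (if i = j then 1 else 0)"
proof -
  have "transpose_mat (transpose_mat M * T.X) $$ (i,j) = (transpose_mat M * T.X) $$ (j,i)"
    using T.MX_carrier assms by (intro index_transpose_mat) auto
  then show ?thesis using T.MX_nth[OF assms] by (auto simp: WM_eq)
qed

text \<open>Bracketed as \<open>(W * M) * X\<close> the product has two upper triangular factors, as
  \<open>W * (M * X)\<close> two lower triangular ones. Hence it is diagonal, and its diagonal is
  that of \<open>W\<close> because \<open>M * X\<close> has unit diagonal.\<close>

lemma WMX_nth:
  assumes "i < n" "j < n"
  shows "(W * M * X) $$ (i,j) = (if i = j then B (Suc i) $$ (i,i) else 0)"
proof (cases "j < i")
  case True
  have "(W * M * X) $$ (i,j) = (\<Sum>k<n. (W * M) $$ (i,k) * X $$ (k,j))"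
    using assms by (intro mult_mat_nth[OF WM_carrier X_carrier])
  also have "\<dots> = 0"
  proof (intro sum.neutral ballI)
    fix k assume "k \<in> {..<n}"
    then show "(W * M) $$ (i,k) * X $$ (k,j) = 0"
      using True assms WM_nth[of k i] by (cases "k \<le> j") (auto simp: X_def)
  qed
  finally show ?thesis using True by simp
next
  case False
  have "(W * M * X) $$ (i,j) = (W * (M * X)) $$ (i,j)"
    using assoc_mult_mat[OF W_carrier M X_carrier] by simp
  also have "\<dots> = (\<Sum>k<n. W $$ (i,k) * (M * X) $$ (k,j))"
    using assms by (intro mult_mat_nth[OF W_carrier MX_carrier])
  also have "\<dots> = (\<Sum>k<n. if k = i then (if i = j then B (Suc i) $$ (i,i) else 0) else 0)"
  proof (intro sum.cong refl)
    fix k assume "k \<in> {..<n}"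
    then show "W $$ (i,k) * (M * X) $$ (k,j)
        = (if k = i then (if i = j then B (Suc i) $$ (i,i) else 0) else 0)"
      using False assms MX_nth[of k j] by (cases "k \<le> i") (auto simp: W_nth)
  qed
  also have "\<dots> = (if i = j then B (Suc i) $$ (i,i) else 0)" using assms by simp
  finally show ?thesis .
qed

text \<open>By Cramer's rule the diagonal entries are the quotients of consecutive leading principal
  minors, that is, the diagonal of U.\<close>

definition pivots :: "real mat" where
  "pivots = Matrix.mat n n (\<lambda>(i,j). if i = j then 1 / B (Suc i) $$ (i,i) else 0)"

lemma pivots_carrier: "pivots \<in> carrier_mat n n"
  by (simp add: pivots_def)

lemma pivots_mult_nth:
  assumes "A \<in> carrier_mat n n" "i < n" "j < n"
  shows "(pivots * A) $$ (i,j) = A $$ (i,j) / B (Suc i) $$ (i,i)"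
proof -
  have "(pivots * A) $$ (i,j) = (\<Sum>k<n. pivots $$ (i,k) * A $$ (k,j))"
    using assms by (intro mult_mat_nth[OF pivots_carrier])
  also have "\<dots> = (\<Sum>k<n. if k = i then A $$ (i,j) / B (Suc i) $$ (i,i) else 0)"
    using assms by (intro sum.cong refl) (auto simp: pivots_def)
  finally show ?thesis using assms by simp
qed

lemma pivots_norm: "spec_norm pivots \<le> C * (1 + C / \<gamma>)"
proof (rule spec_norm_leI[OF pivots_carrier])
  let ?K = "C * (1 + C / \<gamma>)"
  show K0: "?K \<ge> 0" using C \<gamma> by simp
  fix v :: "real Matrix.vec" assume v: "v \<in> carrier_vec n"
  have "(vec_index (pivots *\<^sub>v v) i)\<^sup>2 \<le> (?K * vec_index v i)\<^sup>2" if i: "i < n" for i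
  proof -
    let ?b = "B (Suc i) $$ (i,i)"
    have "vec_index (pivots *\<^sub>v v) i = (\<Sum>k<n. pivots $$ (i,k) * vec_index v k)"
      by (rule mult_mat_vec_nth[OF pivots_carrier v i])
    also have "\<dots> = (\<Sum>k<n. if k = i then vec_index v i / ?b else 0)"
      using i by (intro sum.cong refl) (auto simp: pivots_def)
    finally have eq: "vec_index (pivots *\<^sub>v v) i = vec_index v i / ?b" using i by simp
    have "?b \<noteq> 0" using pivot_bound[OF i] by auto
    then have "1 / \<bar>?b\<bar> \<le> ?K" using pivot_bound[OF i] by (simp add: pos_divide_le_eq)
    then have "1 / \<bar>?b\<bar> * \<bar>vec_index v i\<bar> \<le> ?K * \<bar>vec_index v i\<bar>"
      by (intro mult_right_mono) auto
    then have "\<bar>vec_index v i / ?b\<bar> \<le> \<bar>?K * vec_index v i\<bar>"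
      using K0 by (simp only: abs_mult[of ?K] abs_of_nonneg abs_divide) simp
    then show ?thesis unfolding eq abs_le_square_iff .
  qed
  then have "(vec_l2 (pivots *\<^sub>v v))\<^sup>2 \<le> (\<Sum>i<n. (?K * vec_index v i)\<^sup>2)"
    unfolding vec_l2_power2 using pivots_carrier by (auto intro!: sum_mono simp del: index_mult_mat_vec)
  also have "\<dots> = (?K * vec_l2 v)\<^sup>2"
    using v unfolding power_mult_distrib[of _ "vec_l2 v"] vec_l2_power2
    by (simp add: power_mult_distrib sum_distrib_left)
  finally show "vec_l2 (pivots *\<^sub>v v) \<le> ?K * vec_l2 v"
    by (rule power2_le_imp_le) (use K0 vec_l2_nonneg in auto)
qed

text \<open>This single identity supplies both inverses: \<open>pivots * W\<close> is a left inverse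
  of \<open>M * X\<close>, and \<open>X\<close> is a right inverse of
  \<open>pivots * (W * M)\<close>.\<close>

lemma pivots_WMX: "pivots * (W * M * X) = 1\<^sub>m n"
proof (rule eq_matI)
  fix i j assume "i < dim_row (1\<^sub>m n :: real mat)" "j < dim_col (1\<^sub>m n :: real mat)"
  then have ij: "i < n" "j < n" by auto
  have "B (Suc i) $$ (i,i) \<noteq> 0" using pivot_bound[OF ij(1)] by auto
  moreover have "W * M * X \<in> carrier_mat n n" using WM_carrier X_carrier by simp
  ultimately show "(pivots * (W * M * X)) $$ (i,j) = 1\<^sub>m n $$ (i,j)"
    using ij by (simp only: pivots_mult_nth WMX_nth) auto
qed (use pivots_carrier X_carrier in auto)

lemma LU_factorization:
  assumes e: "0 < e" "e < 1 / 2" "256 * C\<^sup>2 * e\<^sup>2 \<le> \<gamma>\<^sup>2"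
  defines "a \<equiv> C * sqrt (8 / (\<gamma>\<^sup>2 * (1 - 2 * e)))" and "K \<equiv> C * (1 + C / \<gamma>)"
  shows "\<exists>L U Linv Uinv. L \<in> carrier_mat n n \<and> U \<in> carrier_mat n n \<and> M = L * U \<and>
         unit_lower_triangular L \<and> upper_triangular U \<and>
         is_inverse_of Linv L \<and> is_inverse_of Uinv U \<and>
         spec_norm L + spec_norm U + spec_norm Linv + spec_norm Uinv
           \<le> (a + K * a + K * (a / \<gamma>) + a / \<gamma>) * real n powr (1 / 2 - e)"
proof (intro exI conjI)
  \<comment> \<open>The inverse of U is \<open>X\<close>. In the constant, \<open>a\<close> comes
    from \<open>M * X\<close> and \<open>W * M\<close>, division by \<gamma> from passing to
    \<open>X\<close> and \<open>W\<close>, and \<open>K\<close> from the pivots.\<close>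
  define L U Linv where "L = M * X" and "U = pivots * (W * M)" and "Linv = pivots * W"
  define f where "f = real n powr (1 / 2 - e)"
  note carriers = M X_carrier W_carrier WM_carrier MX_carrier pivots_carrier
  have af: "a * f \<ge> 0" using C e by (simp add: a_def f_def)
  have K0: "K \<ge> 0" using C \<gamma> by (simp add: K_def)
  show L: "L \<in> carrier_mat n n" and U: "U \<in> carrier_mat n n"
    using carriers by (auto simp: L_def U_def)
  have Linv: "Linv \<in> carrier_mat n n" using carriers by (auto simp: Linv_def)
  have Linv_L: "Linv * L = 1\<^sub>m n"
    using pivots_WMX carriers
    by (simp add: Linv_def L_def assoc_mult_mat[of _ n n _ n _ n])
  have L_Linv: "L * Linv = 1\<^sub>m n" by (rule mat_mult_left_right_inverse[OF Linv L Linv_L])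
  have UX: "U * X = 1\<^sub>m n"
    using pivots_WMX carriers by (simp add: U_def assoc_mult_mat[of _ n n _ n _ n])
  have XU: "X * U = 1\<^sub>m n" by (rule mat_mult_left_right_inverse[OF U X_carrier UX])
  have "L * U = L * (Linv * M)" using carriers by (simp add: U_def Linv_def assoc_mult_mat[of _ n n _ n _ n])
  also have "\<dots> = (L * Linv) * M" by (rule assoc_mult_mat[OF L Linv M, symmetric])
  also have "\<dots> = M" using L_Linv M by simp
  finally show "M = L * U" ..
  show "unit_lower_triangular L"
    unfolding unit_lower_triangular_def using L MX_nth by (auto simp: L_def simp del: index_mult_mat(1))
  show "upper_triangular U"
    unfolding upper_triangular_def
  proof (intro allI impI)
    fix i j assume "i < dim_row U" "j < i"
    then have "j \<le> i" "i < n" "j < n" "i \<noteq> j" using U by auto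
    then show "U $$ (i,j) = 0" by (simp only: U_def pivots_mult_nth[OF WM_carrier] WM_nth) simp
  qed
  show "is_inverse_of Linv L"
    using L Linv L_Linv Linv_L by (simp add: is_inverse_of_def inverts_mat_def)
  show "is_inverse_of X U"
    using U X_carrier UX XU by (simp add: is_inverse_of_def inverts_mat_def)
  have nL: "spec_norm L \<le> a * f" unfolding L_def a_def f_def by (rule MX_norm[OF e])
  \<comment> \<open>The bound for the transposed matrix is needed for \<open>W * M\<close>, which is
    the transpose of the corresponding product.\<close>
  have nT: "spec_norm (transpose_mat M * T.X) \<le> a * f" unfolding a_def f_def
    by (rule stable_sections.MX_norm[OF transpose_stable_sections e])
  have nWM: "spec_norm (W * M) \<le> a * f"
    unfolding WM_eq by (rule spec_norm_transpose_le[OF T.MX_carrier nT af])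
  have nX: "spec_norm X \<le> a * f / \<gamma>" using nL af unfolding L_def by (rule X_norm)
  have nW: "spec_norm W \<le> a * f / \<gamma>"
    unfolding W_def using \<gamma> af by (intro spec_norm_transpose_le[OF T.X_carrier] T.X_norm[OF nT af]) auto
  have nU: "spec_norm U \<le> K * (a * f)"
    unfolding U_def K_def
    by (rule spec_norm_mult_le[OF pivots_carrier WM_carrier pivots_norm _ nWM af]) (use K0 K_def in simp)
  have nLinv: "spec_norm Linv \<le> K * (a * f / \<gamma>)"
    unfolding Linv_def K_def
    by (rule spec_norm_mult_le[OF pivots_carrier W_carrier pivots_norm _ nW]) (use K0 K_def af \<gamma> in auto)
  have "spec_norm L + spec_norm U + spec_norm Linv + spec_norm X
      \<le> a * f + K * (a * f) + K * (a * f / \<gamma>) + a * f / \<gamma>"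
    using nL nU nLinv nX by linarith
  also have "\<dots> = (a + K * a + K * (a / \<gamma>) + a / \<gamma>) * f"
    by (simp add: algebra_simps)
  finally show "spec_norm L + spec_norm U + spec_norm Linv + spec_norm X
      \<le> (a + K * a + K * (a / \<gamma>) + a / \<gamma>) * real n powr (1 / 2 - e)"
    unfolding f_def .
qed

end

section \<open>Choice of the exponent and the constant\<close>

theorem mainTheorem8:
  fixes C \<gamma> :: real
  assumes "C > 0" and "\<gamma> > 0"
  shows "\<exists>C_LU p. C_LU > 0 \<and> p > 2 \<and>
    (\<forall>(n::nat) (M::real mat). M \<in> carrier_mat n n \<longrightarrow> spec_norm M \<le> C \<longrightarrow>
      (\<forall>j\<in>{1..n}. \<exists>B. is_inverse_of B (ul_sub M j) \<and> spec_norm B \<le> 1 / \<gamma>) \<longrightarrow>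
      (\<exists>L U Linv Uinv. L \<in> carrier_mat n n \<and> U \<in> carrier_mat n n \<and> M = L * U \<and>
         unit_lower_triangular L \<and> upper_triangular U \<and>
         is_inverse_of Linv L \<and> is_inverse_of Uinv U \<and>
         spec_norm L + spec_norm U + spec_norm Linv + spec_norm Uinv
           \<le> C_LU * real n powr (1 / p)))"
proof -
  \<comment> \<open>The second entry secures the absorption condition
    \<open>256 * C\<^sup>2 * e\<^sup>2 \<le> \<gamma>\<^sup>2\<close>, the first keeps
    \<open>e\<close> below 1/2. Both depend on \<open>C\<close> and \<gamma> at most, so the same
    holds for \<open>p\<close>, where 1/p = 1/2 - e.\<close>
  define e where "e = min (1 / 4) (\<gamma> / (16 * C))"
  have e: "0 < e" "e < 1 / 2" using assms by (auto simp: e_def)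
  have "16 * C * e \<le> 16 * C * (\<gamma> / (16 * C))"
    using assms by (intro mult_left_mono) (auto simp: e_def)
  then have "(16 * C * e)\<^sup>2 \<le> \<gamma>\<^sup>2" using assms e by (intro power_mono) auto
  then have e3: "256 * C\<^sup>2 * e\<^sup>2 \<le> \<gamma>\<^sup>2" by (simp add: power_mult_distrib)
  define a where "a = C * sqrt (8 / (\<gamma>\<^sup>2 * (1 - 2 * e)))"
  define K where "K = C * (1 + C / \<gamma>)"
  define C' where "C' = a + K * a + K * (a / \<gamma>) + a / \<gamma>"
  define p where "p = 1 / (1 / 2 - e)"
  have "a > 0" using assms e by (simp add: a_def)
  moreover have "K > 0" using assms by (simp add: K_def add_pos_pos)
  ultimately have "C' > 0" using assms by (simp add: C'_def add_pos_pos)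
  moreover have "p > 2" using e by (simp add: p_def field_simps)
  moreover have "\<exists>L U Linv Uinv. L \<in> carrier_mat n n \<and> U \<in> carrier_mat n n \<and> M = L * U \<and>
         unit_lower_triangular L \<and> upper_triangular U \<and>
         is_inverse_of Linv L \<and> is_inverse_of Uinv U \<and>
         spec_norm L + spec_norm U + spec_norm Linv + spec_norm Uinv \<le> C' * real n powr (1 / p)"
    if M: "M \<in> carrier_mat n n" "spec_norm M \<le> C"
      and inv: "\<forall>j\<in>{1..n}. \<exists>B. is_inverse_of B (ul_sub M j) \<and> spec_norm B \<le> 1 / \<gamma>" for n M
  proof -
    obtain B where "\<forall>j\<in>{1..n}. is_inverse_of (B j) (ul_sub M j) \<and> spec_norm (B j) \<le> 1 / \<gamma>"
      using bchoice[OF inv] by blast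
    then interpret stable_sections n M B C \<gamma>
      using assms M by unfold_locales auto
    have "1 / p = 1 / 2 - e" by (simp add: p_def)
    then show ?thesis
      using LU_factorization[OF e e3] unfolding C'_def a_def K_def by simp
  qed
  ultimately show ?thesis by blast
qed

end
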